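(* There are absolute constants $a>0$, $c>0$ and $\epsilon_0>0$ such that for all integers $k\ge3$ and $n\ge\log k+\log\log k+a$ and all $0<\epsilon<\epsilon_0$, the class $\mathcal{B}_{n,k}$ of decision trees with $k$ nodes over $\{0,1\}^n$ satisfies $$m^{\mathrm{test}}_\epsilon(\mathcal{B}_{n,k})\ge c\cdot\frac{k}{\log k\cdot\log\log k}\qquad\text{and}\qquad q^{\mathrm{test}}_{0,\epsilon}(\mathcal{B}_{n,k})\ge c\cdot\frac{k}{\log k\cdot\log\log k}.$$
   Context: $\log$ is base $2$. $\mathcal{B}_{n,k}$ is the set of functions $f:\{0,1\}^n\to\{0,1\}$ computed by (binary) decision trees with (at most) $k$ internal nodes, where each node is a test of the form "$x_i=1$?" and each leaf is labelled $0$ or $1$. For a class $\mathcal{H}$ of functions $\mathcal{X}\to\{0,1\}$ and a probability distribution $\mathcal{D}$ on $\mathcal{X}$, $\mathrm{dist}_{\mathcal{D}}(f,g)=\Pr_{x\sim\mathcal{D}}[f(x)\ne g(x)]$ and $\mathrm{dist}_{\mathcal{D}}(f,\mathcal{H})=\inf_{h\in\mathcal{H}}\mathrm{dist}_{\mathcal{D}}(f,h)$. All testers are computationally unbounded randomized algorithms that must work for every unknown distribution $\mathcal{D}$ on $\mathcal{X}$ and every unknown $f:\mathcal{X}\to\{0,1\}$. (i) $m^{\mathrm{test}}_\epsilon(\mathcal{H})$ is the minimum $m$ such that some algorithm receiving $m$ labelled examples $(x,f(x))$, $x\sim\mathcal{D}$ independently, accepts with probability $\ge 2/3$ if $f\in\mathcal{H}$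 and rejects with probability $\ge2/3$ if $\mathrm{dist}_{\mathcal{D}}(f,\mathcal{H})\ge\epsilon$. (ii) $q^{\mathrm{test}}_{0,\epsilon}(\mathcal{H})$ is the minimum $q$ such that some algorithm making in total at most $q$ adaptive queries to $f$ at arbitrary points of $\mathcal{X}$ and independent labelled samples $(x,f(x))$, $x\sim\mathcal{D}$, accepts with probability $\ge2/3$ if $\mathrm{dist}_{\mathcal{D}}(f,\mathcal{H})=0$ and rejects with probability $\ge2/3$ if $\mathrm{dist}_{\mathcal{D}}(f,\mathcal{H})\ge\epsilon$. *)

theory Defs
  imports "HOL-Probability.Probability"
begin

section \<open>Property testing with respect to an unknown distribution\<close>

text \<open>
  The domain is a finite carrier set \<open>X\<close>; functions on it are the extensional
  elements of \<open>X \<rightarrow>\<^sub>E UNIV\<close>, so that membership in a class is literal equality, and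
  distributions on it are the probability mass functions with support in \<open>X\<close>.
\<close>

definition dist_fun :: "'a pmf \<Rightarrow> ('a \<Rightarrow> bool) \<Rightarrow> ('a \<Rightarrow> bool) \<Rightarrow> real" where
  "dist_fun D f g = measure_pmf.prob D {x. f x \<noteq> g x}"

text \<open>The infimum is only meaningful for nonempty classes.\<close>

definition dist_class :: "'a pmf \<Rightarrow> ('a \<Rightarrow> bool) \<Rightarrow> ('a \<Rightarrow> bool) set \<Rightarrow> real" where
  "dist_class D f H = (INF h\<in>H. dist_fun D f h)"


subsection \<open>Testing from samples\<close>

definition labelled_samples :: "nat \<Rightarrow> 'a pmf \<Rightarrow> ('a \<Rightarrow> bool) \<Rightarrow> ('a \<times> bool) list pmf" where
  "labelled_samples m D f = map_pmf (map (\<lambda>x. (x, f x))) (replicate_pmf m D)"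

text \<open>
  A randomized algorithm maps the sample to a distribution on verdicts
  (\<open>True\<close> is acceptance).
\<close>

definition sample_tester ::
    "'a set \<Rightarrow> ('a \<Rightarrow> bool) set \<Rightarrow> real \<Rightarrow> nat \<Rightarrow> (('a \<times> bool) list \<Rightarrow> bool pmf) \<Rightarrow> bool" where
  "sample_tester X H \<epsilon> m A \<longleftrightarrow>
     (\<forall>D f. set_pmf D \<subseteq> X \<longrightarrow> f \<in> X \<rightarrow>\<^sub>E UNIV \<longrightarrow>
        (f \<in> H \<longrightarrow> pmf (bind_pmf (labelled_samples m D f) A) True \<ge> 2/3) \<and>
        (dist_class D f H \<ge> \<epsilon> \<longrightarrow> pmf (bind_pmf (labelled_samples m D f) A) False \<ge> 2/3))"

text \<open>Both complexities below are \<open>\<infinity>\<close> if there is no tester at all.\<close>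

definition m_test :: "'a set \<Rightarrow> ('a \<Rightarrow> bool) set \<Rightarrow> real \<Rightarrow> enat" where
  "m_test X H \<epsilon> = Inf {enat m | m. \<exists>A. sample_tester X H \<epsilon> m A}"


subsection \<open>Testing from queries and samples\<close>

text \<open>
  A deterministic adaptive algorithm: \<open>Query x K\<close> asks for \<open>f x\<close> and continues with
  \<open>K (f x)\<close>; \<open>Sample K\<close> draws a fresh \<open>x\<close> and continues with \<open>K (x, f x)\<close>.
\<close>

datatype 'a alg =
    Verdict bool
  | Query 'a "bool \<Rightarrow> 'a alg"
  | Sample "'a \<times> bool \<Rightarrow> 'a alg"

primrec run_alg :: "'a pmf \<Rightarrow> ('a \<Rightarrow> bool) \<Rightarrow> 'a alg \<Rightarrow> bool pmf" where
  "run_alg D f (Verdict b) = return_pmf b"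
| "run_alg D f (Query x K) = run_alg D f (K (f x))"
| "run_alg D f (Sample K) = bind_pmf D (\<lambda>x. run_alg D f (K (x, f x)))"

text \<open>
  At most \<open>q\<close> queries and samples in total on every computation path, all queries being
  points of \<open>X\<close>.
\<close>

inductive cost_le :: "'a set \<Rightarrow> nat \<Rightarrow> 'a alg \<Rightarrow> bool" for X :: "'a set" where
  "cost_le X q (Verdict b)"
| "x \<in> X \<Longrightarrow> (\<And>b. cost_le X q (K b)) \<Longrightarrow> cost_le X (Suc q) (Query x K)"
| "(\<And>x b. x \<in> X \<Longrightarrow> cost_le X q (K (x, b))) \<Longrightarrow> cost_le X (Suc q) (Sample K)"

text \<open>
  A randomized algorithm is a distribution on deterministic ones. As there are only finitely
  many deterministic algorithms of cost at most \<open>q\<close> over a finite \<open>X\<close> (up to behaviour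
  outside \<open>X\<close>), discrete distributions lose no generality, and coins tossed during
  the computation may as well be tossed in advance.
\<close>

definition query_tester_0 ::
    "'a set \<Rightarrow> ('a \<Rightarrow> bool) set \<Rightarrow> real \<Rightarrow> nat \<Rightarrow> 'a alg pmf \<Rightarrow> bool" where
  "query_tester_0 X H \<epsilon> q R \<longleftrightarrow>
     (\<forall>A\<in>set_pmf R. cost_le X q A) \<and>
     (\<forall>D f. set_pmf D \<subseteq> X \<longrightarrow> f \<in> X \<rightarrow>\<^sub>E UNIV \<longrightarrow>
        (dist_class D f H = 0 \<longrightarrow> pmf (bind_pmf R (run_alg D f)) True \<ge> 2/3) \<and>
        (dist_class D f H \<ge> \<epsilon> \<longrightarrow> pmf (bind_pmf R (run_alg D f)) False \<ge> 2/3))"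

definition q_test_0 :: "'a set \<Rightarrow> ('a \<Rightarrow> bool) set \<Rightarrow> real \<Rightarrow> enat" where
  "q_test_0 X H \<epsilon> = Inf {enat q | q. \<exists>R. query_tester_0 X H \<epsilon> q R}"


section \<open>Decision trees\<close>

definition cube :: "nat \<Rightarrow> bool list set" where
  "cube n = {x. length x = n}"

text \<open>In \<open>Test i t0 t1\<close> the subtree \<open>t1\<close> is taken if \<open>x\<^sub>i = 1\<close>; coordinates count from 0.\<close>

datatype (tests: 'i) dtree = Leaf bool | Test 'i "'i dtree" "'i dtree"

primrec eval_dtree :: "nat dtree \<Rightarrow> bool list \<Rightarrow> bool" where
  "eval_dtree (Leaf b) x = b"
| "eval_dtree (Test i t0 t1) x = (if x ! i then eval_dtree t1 x else eval_dtree t0 x)"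

primrec inner_nodes :: "'i dtree \<Rightarrow> nat" where
  "inner_nodes (Leaf b) = 0"
| "inner_nodes (Test i t0 t1) = Suc (inner_nodes t0 + inner_nodes t1)"

definition decision_trees :: "nat \<Rightarrow> nat \<Rightarrow> (bool list \<Rightarrow> bool) set" where
  "decision_trees n k =
     {restrict (eval_dtree t) (cube n) | t. tests t \<subseteq> {..<n} \<and> inner_nodes t \<le> k}"

end

theory Submission
  imports Defs
begin

text \<open>
  The tester may as well know the labelling \<open>f\<close>, the parity of the first \<open>s\<close> coordinates with
  \<open>4 k \<le> 2 ^ s \<le> 8 k\<close>; only the distribution on the \<open>s\<close>-dimensional subcube is hidden, so queries
  are useless. Every function agrees with a tree with \<open>k\<close> nodes on any \<open>k\<close> points, whereas parity
  is far from all such trees under any distribution with density bounded below on the subcube.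

  It remains to hide whether the support is small. Give the \<open>N = 2 ^ s\<close> points of the subcube
  independent weights from one of two priors with the same first \<open>O(log N)\<close> moments, one mostly
  zero and one at least \<open>1\<close>, and normalise. Drawing uniform points and keeping each with
  probability proportional to its weight simulates samples from the normalised weights without
  Poissonization, and the two priors cannot be told apart unless some point is drawn more than
  \<open>2 s\<close> times. This takes of the order of \<open>N s\<close> uniform draws, of which a fraction of
  the order of \<open>1 / s\<^sup>2\<close> is kept, so that about \<open>k / log k\<close> samples are needed.
\<close>

section \<open>Priors with matching moments\<close>

text \<open>Write a factor as \<open>a + b * y = b * (y - x s) + (a + b * x s)\<close>. In the first
  term \<open>y - x s\<close> cancels the node \<open>s\<close>, so that a factor and a node
  disappear together; the second term loses a factor only. What remains is a constant on at least
  two nodes. Polynomials come as lists of linear factors because likelihoods of marks have this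
  form.\<close>

lemma divided_difference_products_eq_0:
  fixes x :: "'i \<Rightarrow> real"
  assumes "finite I" "inj_on x I" "length fs + 1 < card I"
  shows "(\<Sum>i\<in>I. (\<Prod>(a, b)\<leftarrow>fs. a + b * x i) / (\<Prod>m\<in>I - {i}. x i - x m)) = 0"
proof -
  define dd where "dd = (\<lambda>I g. \<Sum>i\<in>I. g (x i) / (\<Prod>m\<in>I - {i}. x i - x m))"
  have reduce: "dd I (\<lambda>y. (y - x s) * g y) = dd (I - {s}) g"
    if "finite I" "inj_on x I" "s \<in> I" for I g s
  proof -
    have "dd I (\<lambda>y. (y - x s) * g y) =
        (\<Sum>i\<in>I - {s}. (x i - x s) * g (x i) / (\<Prod>m\<in>I - {i}. x i - x m))"
      unfolding dd_def using that by (simp add: sum.remove)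
    also have "\<dots> = dd (I - {s}) g"
      unfolding dd_def
    proof (rule sum.cong)
      fix i assume i: "i \<in> I - {s}"
      have "(\<Prod>m\<in>I - {i}. x i - x m) = (x i - x s) * (\<Prod>m\<in>I - {i} - {s}. x i - x m)"
        using that i by (intro prod.remove) auto
      moreover have "x i - x s \<noteq> 0" using that i by (auto dest: inj_onD)
      moreover have "I - {i} - {s} = I - {s} - {i}" by auto
      ultimately show "(x i - x s) * g (x i) / (\<Prod>m\<in>I - {i}. x i - x m) =
          g (x i) / (\<Prod>m\<in>I - {s} - {i}. x i - x m)" by simp
    qed simp
    finally show ?thesis .
  qed
  have const: "dd I (\<lambda>y. 1) = 0" if "finite I" "inj_on x I" "2 \<le> card I" for I
    using that
  proof (induction "card I" arbitrary: I rule: less_induct)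
    case less
    from \<open>2 \<le> card I\<close> obtain s r where sr: "s \<in> I" "r \<in> I" "s \<noteq> r"
      by (metis card_le_Suc0_iff_eq less.prems(1) not_less_eq_eq numeral_2_eq_2)
    have ne: "x r - x s \<noteq> 0" using less.prems sr by (auto dest: inj_onD)
    have lin: "dd I (\<lambda>y. (f y - g y) / c) = (dd I f - dd I g) / c" for f g c
      unfolding dd_def
      by (simp add: sum_subtractf sum_divide_distrib diff_divide_distrib mult.commute)
    \<comment> \<open>The constant is a difference of two linear factors, each of which cancels one
      node. With two nodes both remaining terms are \<open>1\<close>; with more they vanish by
      induction.\<close>
    have "dd I (\<lambda>y. 1) = dd I (\<lambda>y. ((y - x s) * 1 - (y - x r) * 1) / (x r - x s))"
      using ne by simp
    also have "\<dots> = (dd I (\<lambda>y. (y - x s) * 1) - dd I (\<lambda>y. (y - x r) * 1)) / (x r - x s)"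
      by (rule lin)
    also have "\<dots> = (dd (I - {s}) (\<lambda>y. 1) - dd (I - {r}) (\<lambda>y. 1)) / (x r - x s)"
      using reduce[of I s "\<lambda>_. 1"] reduce[of I r "\<lambda>_. 1"] less.prems sr by simp
    also have "\<dots> = 0"
    proof (cases "card I = 2")
      case True
      then have "I = {s, r}" using sr
        by (metis card_2_iff doubleton_eq_iff insertE singletonD)
      then have "I - {s} = {r}" "I - {r} = {s}" using sr by auto
      then show ?thesis by (simp add: dd_def)
    next
      case False
      have "dd (I - {z}) (\<lambda>y. 1) = 0" if "z \<in> I" for z
        using less.prems False that
        by (intro less.hyps) (auto intro: inj_on_subset)
      then show ?thesis using sr by simp
    qed
    finally show ?case .
  qed
  have "dd I (\<lambda>y. \<Prod>(a, b)\<leftarrow>fs. a + b * y) = 0"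
    using assms
  proof (induction fs arbitrary: I)
    case Nil
    then show ?case using const by simp
  next
    case (Cons f fs)
    obtain a b where f: "f = (a, b)" by fastforce
    obtain s where s: "s \<in> I" using Cons.prems by fastforce
    let ?g = "\<lambda>y. \<Prod>(a, b)\<leftarrow>fs. a + b * y"
    have "dd I (\<lambda>y. \<Prod>(a, b)\<leftarrow>f # fs. a + b * y) =
        dd I (\<lambda>y. b * ((y - x s) * ?g y) + (a + b * x s) * ?g y)"
      by (simp add: f algebra_simps)
    also have "\<dots> = b * dd I (\<lambda>y. (y - x s) * ?g y) + (a + b * x s) * dd I ?g"
      unfolding dd_def by (simp add: sum.distrib sum_distrib_left add_divide_distrib)
    also have "dd I (\<lambda>y. (y - x s) * ?g y) = dd (I - {s}) ?g"
      using reduce[OF Cons.prems(1,2) s] .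
    also have "dd (I - {s}) ?g = 0"
      using Cons.prems s by (intro Cons.IH) (auto intro: inj_on_subset)
    also have "dd I ?g = 0" using Cons.prems by (intro Cons.IH) auto
    finally show ?case by simp
  qed
  then show ?thesis unfolding dd_def .
qed

section \<open>Estimates for Lagrange coefficients at quadratically spaced nodes\<close>

text \<open>The product has the closed form
  \<open>2 * (fact J)\<^sup>2 / (fact (J - j) * fact (J + j))\<close>, twice the quotient of the
  binomial coefficients of \<open>2 * J\<close> at \<open>J - j\<close> and at \<open>J\<close>, and
  the central coefficient is the largest.\<close>

lemma prod_square_quotients_le_2:
  assumes "1 \<le> j" "j \<le> (J::nat)"
  shows "(\<Prod>l\<in>{1..J} - {j}. (real l)\<^sup>2 / \<bar>(real l)\<^sup>2 - (real j)\<^sup>2\<bar>) \<le> 2"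
proof -
  \<comment> \<open>The case \<open>J = j\<close> of the closed form. After factoring the difference
    of squares, the products over \<open>l\<close>, \<open>j - l\<close> and \<open>j + l\<close>
    are factorials or quotients of factorials.\<close>
  have below: "(\<Prod>l\<in>{1..<j}. (real l)\<^sup>2 / \<bar>(real l)\<^sup>2 - (real j)\<^sup>2\<bar>) * fact (2 * j) = 2 * (fact j)\<^sup>2"
  proof -
    have a: "(\<Prod>l\<in>{1..<j}. real l) = fact (j - 1)"
    proof -
      have "{1..<j} = {1..j - 1}" using assms by auto
      then show ?thesis by (simp add: fact_prod)
    qed
    have b: "(\<Prod>l\<in>{1..<j}. real j - real l) = fact (j - 1)"
      unfolding a[symmetric]
      by (rule prod.reindex_bij_witness[of _ "\<lambda>l. j - l" "\<lambda>l. j - l"]) auto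
    have c: "(\<Prod>l\<in>{1..<m}. real j + real l) * fact j = fact (j + m - 1)" if "1 \<le> m" for m
      using that
    proof (induction m rule: dec_induct)
      case (step m)
      have "(\<Prod>l\<in>{1..<Suc m}. real j + real l) * fact j =
         (real j + real m) * ((\<Prod>l\<in>{1..<m}. real j + real l) * fact j)"
        using step by (simp add: prod.atLeastLessThan_Suc)
      also have "\<dots> = real (j + m) * fact (j + m - 1)" using step by simp
      also have "\<dots> = fact (j + m)" using step assms
        by (subst (2) fact_reduce) auto
      finally show ?case by simp
    qed simp
    have "(\<Prod>l\<in>{1..<j}. (real l)\<^sup>2 / \<bar>(real l)\<^sup>2 - (real j)\<^sup>2\<bar>) =
        (\<Prod>l\<in>{1..<j}. (real l * real l) / ((real j - real l) * (real j + real l)))"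
    proof (rule prod.cong)
      fix l assume l: "l \<in> {1..<j}"
      then have "(real l)\<^sup>2 < (real j)\<^sup>2" by (intro power_strict_mono) auto
      then have "\<bar>(real l)\<^sup>2 - (real j)\<^sup>2\<bar> = (real j - real l) * (real j + real l)"
        by (simp add: power2_eq_square algebra_simps)
      then show "(real l)\<^sup>2 / \<bar>(real l)\<^sup>2 - (real j)\<^sup>2\<bar> = (real l * real l) / ((real j - real l) * (real j + real l))"
        by (simp add: power2_eq_square)
    qed simp
    also have "\<dots> = fact (j - 1) * fact (j - 1) /
        (fact (j - 1) * (\<Prod>l\<in>{1..<j}. real j + real l))"
      by (simp only: prod_dividef prod.distrib a b)
    also have "(\<Prod>l\<in>{1..<j}. real j + real l) = fact (2 * j - 1) / fact j"
    proof -
      have "(\<Prod>l\<in>{1..<j}. real j + real l) * fact j = fact (2 * j - 1)"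
        using c[OF assms(1)] by (simp add: mult_2)
      then show ?thesis by (simp add: field_simps)
    qed
    finally have "(\<Prod>l\<in>{1..<j}. (real l)\<^sup>2 / \<bar>(real l)\<^sup>2 - (real j)\<^sup>2\<bar>) =
      fact (j - 1) * fact j / fact (2 * j - 1)" by simp
    moreover have "fact (2 * j) = 2 * real j * fact (2 * j - 1)"
      using assms by (subst fact_reduce) auto
    moreover have "fact j = real j * fact (j - 1)"
      using assms by (subst fact_reduce) auto
    ultimately show ?thesis by (simp add: field_simps power2_eq_square)
  qed
  have closed: "(\<Prod>l\<in>{1..J} - {j}. (real l)\<^sup>2 / \<bar>(real l)\<^sup>2 - (real j)\<^sup>2\<bar>) *
       (fact (J - j) * fact (J + j)) = 2 * (fact J)\<^sup>2"
    using assms(2)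
  proof (induction J rule: dec_induct)
    case base
    have "{1..j} - {j} = {1..<j}" by auto
    moreover have "fact (j - j) * fact (j + j) = (fact (2 * j) :: real)" by (simp flip: mult_2)
    ultimately show ?case using below by (simp only:)
  next
    case (step J)
    have "{1..Suc J} - {j} = insert (Suc J) ({1..J} - {j})" using step by auto
    then have "(\<Prod>l\<in>{1..Suc J} - {j}. (real l)\<^sup>2 / \<bar>(real l)\<^sup>2 - (real j)\<^sup>2\<bar>) =
       (real (Suc J))\<^sup>2 / \<bar>(real (Suc J))\<^sup>2 - (real j)\<^sup>2\<bar> *
       (\<Prod>l\<in>{1..J} - {j}. (real l)\<^sup>2 / \<bar>(real l)\<^sup>2 - (real j)\<^sup>2\<bar>)" by simp
    moreover have "\<bar>(real (Suc J))\<^sup>2 - (real j)\<^sup>2\<bar> = (real (Suc J) - real j) * (real (Suc J) + real j)"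
    proof -
      have "(real j)\<^sup>2 \<le> (real (Suc J))\<^sup>2" using step by (intro power_mono) auto
      then show ?thesis by (simp add: power2_eq_square algebra_simps)
    qed
    moreover have "fact (Suc J - j) = (real (Suc J) - real j) * fact (J - j)"
      using step by (simp add: Suc_diff_le)
    moreover have "fact (Suc J + j) = (real (Suc J) + real j) * fact (J + j)" by simp
    moreover have "real (Suc J) - real j \<noteq> 0" "real (Suc J) + real j \<noteq> 0" using step by auto
    moreover have "(fact (Suc J))\<^sup>2 = (real (Suc J))\<^sup>2 * (fact J)\<^sup>2" by (simp add: power_mult_distrib)
    moreover have "r / (u * v) * p * (u * f * (v * g)) = r * (p * (f * g))"
      if "u \<noteq> 0" "v \<noteq> 0" for r u v p f g :: real
      using that by simp
    ultimately have "(\<Prod>l\<in>{1..Suc J} - {j}. (real l)\<^sup>2 / \<bar>(real l)\<^sup>2 - (real j)\<^sup>2\<bar>) *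
        (fact (Suc J - j) * fact (Suc J + j)) = (real (Suc J))\<^sup>2 *
        ((\<Prod>l\<in>{1..J} - {j}. (real l)\<^sup>2 / \<bar>(real l)\<^sup>2 - (real j)\<^sup>2\<bar>) * (fact (J - j) * fact (J + j)))"
      by (simp only:)
    also have "\<dots> = 2 * (fact (Suc J))\<^sup>2"
      unfolding step.IH by (simp add: power_mult_distrib)
    finally show ?case .
  qed
  have "(fact J)\<^sup>2 \<le> (fact (J - j) * fact (J + j) :: real)"
  proof -
    have "real ((2 * J) choose (J - j)) \<le> real ((2 * J) choose J)"
      using binomial_maximum' by (intro of_nat_mono)
    moreover have "real ((2 * J) choose (J - j)) = fact (2 * J) / (fact (J - j) * fact (J + j))"
      using assms by (subst binomial_fact) (auto simp: mult_2)
    moreover have "real ((2 * J) choose J) = fact (2 * J) / (fact J)\<^sup>2"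
      by (subst binomial_fact) (auto simp: mult_2 power2_eq_square)
    ultimately have "fact (2 * J) / (fact (J - j) * fact (J + j)) \<le> fact (2 * J) / (fact J :: real)\<^sup>2"
      by simp
    then show ?thesis by (simp add: divide_le_cancel field_simps)
  qed
  with closed have "(\<Prod>l\<in>{1..J} - {j}. (real l)\<^sup>2 / \<bar>(real l)\<^sup>2 - (real j)\<^sup>2\<bar>) *
       (fact (J - j) * fact (J + j)) \<le> 2 * (fact (J - j) * fact (J + j))" by simp
  then show ?thesis by (simp add: mult_le_cancel_right_pos)
qed

lemma sum_inverse_squares_le_2: "(\<Sum>l\<in>{1..J}. 1 / (real l)\<^sup>2) \<le> 2"
proof (cases "J = 0")
  case False
  then have "1 \<le> J" by simp
  then have "(\<Sum>l\<in>{1..J}. 1 / (real l)\<^sup>2) \<le> 2 - 1 / real J"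
  proof (induction J rule: dec_induct)
    case (step J)
    have "1 / (real (Suc J))\<^sup>2 \<le> 1 / (real J * real (Suc J))"
      using step by (intro divide_left_mono) (auto simp: power2_eq_square)
    also have "\<dots> = 1 / real J - 1 / real (Suc J)"
      using step by (simp add: field_simps)
    finally have "1 / (real (Suc J))\<^sup>2 \<le> 1 / real J - 1 / real (Suc J)" .
    then show ?case using step.IH by simp
  qed simp
  then show ?thesis by (rule order_trans) simp
qed simp

text \<open>These factors measure how much the Lagrange coefficients at \<open>1\<close> exceed
  those at the nearby node \<open>121\<close>. Convergence of the sum of inverse squares makes the
  excess bounded uniformly in the number of nodes.\<close>

lemma prod_1_plus_inverse_square_le:
  assumes "S \<subseteq> {1..J}"
  shows "(\<Prod>l\<in>S. 1 + 1 / (16 * (real l)\<^sup>2)) \<le> 6 / 5"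
proof -
  have fin: "finite S" using assms finite_subset by blast
  have "(\<Prod>l\<in>S. 1 + 1 / (16 * (real l)\<^sup>2)) \<le> (\<Prod>l\<in>S. exp (1 / (16 * (real l)\<^sup>2)))"
    by (intro prod_mono) (auto simp: exp_ge_add_one_self)
  also have "\<dots> = exp (\<Sum>l\<in>S. 1 / (16 * (real l)\<^sup>2))" using fin by (simp add: exp_sum)
  also have "(\<Sum>l\<in>S. 1 / (16 * (real l)\<^sup>2)) \<le> (\<Sum>l\<in>{1..J}. 1 / (16 * (real l)\<^sup>2))"
    using assms by (intro sum_mono2) auto
  also have "\<dots> = (\<Sum>l\<in>{1..J}. 1 / (real l)\<^sup>2) / 16"
    by (simp add: sum_divide_distrib mult.commute)
  also have "\<dots> \<le> 1 / 8" using sum_inverse_squares_le_2[of J] by simp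
  also have "exp (1 / 8 :: real) \<le> 6 / 5"
    using exp_bound[of "1 / 8 :: real"] by (simp add: power2_eq_square)
  finally show ?thesis by simp
qed

text \<open>
  The quadratic spacing of the nodes \<open>121 + 1920 j\<^sup>2\<close> imitates Chebyshev nodes near the end of
  an interval. The two priors are the positive and negative parts of the divided difference on the
  nodes, normalised so that the node \<open>1\<close> has weight \<open>- 1\<close>; the nodes \<open>w j\<close> then have
  weights \<open>\<rho> j / w j\<close>, where the \<open>\<rho> j\<close> are the Lagrange coefficients at \<open>1\<close>.
\<close>

lemma moment_matching_priors:
  fixes J :: nat
  obtains y \<mu>0 \<mu>1 :: "nat \<Rightarrow> real" where
    "\<And>i. i \<le> J + 2 \<Longrightarrow> 0 \<le> y i"
    "\<And>i. i \<le> J + 2 \<Longrightarrow> y i \<le> 121 + 1920 * (real J)\<^sup>2"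
    "\<And>i. 0 \<le> \<mu>0 i" "\<And>i. 0 \<le> \<mu>1 i"
    "(\<Sum>i\<le>J + 2. \<mu>0 i) = 1" "(\<Sum>i\<le>J + 2. \<mu>1 i) = 1"
    "\<And>fs. length fs \<le> J + 1 \<Longrightarrow>
       (\<Sum>i\<le>J + 2. \<mu>0 i * (\<Prod>(a, b)\<leftarrow>fs. a + b * y i)) =
       (\<Sum>i\<le>J + 2. \<mu>1 i * (\<Prod>(a, b)\<leftarrow>fs. a + b * y i))"
    "(\<Sum>i\<le>J + 2. \<mu>0 i * of_bool (y i \<noteq> 0)) \<le> 1 / 80"
    "\<And>i. i \<le> J + 2 \<Longrightarrow> \<mu>1 i \<noteq> 0 \<Longrightarrow> 1 \<le> y i"
    "(\<Sum>i\<le>J + 2. \<mu>1 i * y i) \<le> 13 / 10"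
    "y 2 = 121" "1 / 2 \<le> \<mu>0 2 * y 2" "y 1 = 1" "1 / 2 \<le> \<mu>1 1 * y 1"
proof -
  define w where "w = (\<lambda>j::nat. 121 + 1920 * (real j)\<^sup>2)"
  define y where "y = (\<lambda>i. if i = 0 then 0 else if i = 1 then 1 else w (i - 2))"
  \<comment> \<open>The factors are \<open>(1 - w l) / (w j - w l)\<close>. Since
    \<open>1 - w l = - (120 + 1920 * (real l)\<^sup>2)\<close>, cancelling \<open>- 1920\<close>
    leaves \<open>1 / 16 = 120 / 1920\<close>.\<close>
  define \<rho> where "\<rho> = (\<lambda>j. \<Prod>l\<in>{..J} - {j}. (1 / 16 + (real l)\<^sup>2) / ((real l)\<^sup>2 - (real j)\<^sup>2))"
  have split: "(\<Sum>i\<le>J + 2. g i) = g 0 + g 1 + (\<Sum>j\<le>J. g (j + 2))" for g :: "nat \<Rightarrow> real"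
    by (simp add: sum.atMost_Suc_shift del: sum.atMost_Suc)
  have y_simps: "y 0 = 0" "y 1 = 1" "y (j + 2) = w j" for j by (auto simp: y_def)
  have y_Suc: "y (Suc 0) = 1" "y (Suc (Suc j)) = w j" for j by (auto simp: y_def)
  have w_ge: "121 \<le> w j" for j by (simp add: w_def)
  have w_diff: "w j - w l = 1920 * ((real j)\<^sup>2 - (real l)\<^sup>2)" for j l by (simp add: w_def)
  have w_inj: "w j = w l \<longleftrightarrow> j = l" for j l using power2_eq_iff_nonneg[of "real j" "real l"] by (simp add: w_def)
  have y_inj: "inj_on y {..J + 2}"
  proof -
    have "w j \<noteq> 0" "w j \<noteq> 1" "0 \<noteq> w j" "1 \<noteq> w j" for j using w_ge[of j] by auto
    then show ?thesis by (auto simp: inj_on_def y_def w_inj split: if_splits)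
  qed
  let ?I = "{..J + 2}"
  define d where "d = (\<lambda>i. \<Prod>m\<in>?I - {i}. y i - y m)"
  have d1: "d 1 = (\<Prod>l\<le>J. 1 - w l)"
  proof -
    have "?I - {1} = insert 0 ((\<lambda>l. l + 2) ` {..J})"
    proof -
      have "m \<in> (\<lambda>l. l + 2) ` {..J}" if "m \<le> J + 2" "2 \<le> m" for m
        using that by (intro image_eqI[of _ _ "m - 2"]) auto
      then show ?thesis by force
    qed
    then show ?thesis
      unfolding d_def by (simp add: prod.reindex y_simps y_Suc inj_on_def image_iff)
  qed
  have d2: "d (j + 2) = w j * ((w j - 1) * (\<Prod>l\<in>{..J} - {j}. w j - w l))" if "j \<le> J" for j
  proof -
    have "?I - {j + 2} = insert 0 (insert 1 ((\<lambda>l. l + 2) ` ({..J} - {j})))"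
    proof -
      have "m \<in> (\<lambda>l. l + 2) ` ({..J} - {j})" if "m \<le> J + 2" "2 \<le> m" "m \<noteq> j + 2" for m
        using that by (intro image_eqI[of _ _ "m - 2"]) auto
      then show ?thesis by force
    qed
    then show ?thesis
      unfolding d_def by (simp add: prod.reindex y_simps y_Suc inj_on_def image_iff)
  qed
  have "1 - w l \<noteq> 0" for l using w_ge[of l] by simp
  then have d1_nz: "d 1 \<noteq> 0" unfolding d1 by simp
  have ratio: "d 1 / d (j + 2) = - (\<rho> j / w j)" if "j \<le> J" for j
  proof -
    have "d 1 = (1 - w j) * (\<Prod>l\<in>{..J} - {j}. 1 - w l)"
      unfolding d1 using that by (intro prod.remove) auto
    moreover have "\<rho> j = (\<Prod>l\<in>{..J} - {j}. 1 - w l) / (\<Prod>l\<in>{..J} - {j}. w j - w l)"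
      unfolding \<rho>_def prod_dividef[symmetric]
    proof (rule prod.cong)
      fix l assume "l \<in> {..J} - {j}"
      have "(1 - w l) / (w j - w l) = ((- 1920) * (1 / 16 + (real l)\<^sup>2)) / ((- 1920) * ((real l)\<^sup>2 - (real j)\<^sup>2))"
        unfolding w_diff by (simp add: w_def)
      also have "\<dots> = (1 / 16 + (real l)\<^sup>2) / ((real l)\<^sup>2 - (real j)\<^sup>2)"
        by (rule mult_divide_mult_cancel_left) simp
      finally show "(1 / 16 + (real l)\<^sup>2) / ((real l)\<^sup>2 - (real j)\<^sup>2) = (1 - w l) / (w j - w l)" ..
    qed simp
    moreover have "(1 - u) * A / (u * ((u - 1) * C)) = - (A / C / u)" if "u \<noteq> 1" for u A C :: real
    proof -
      have "(1 - u) * A / (u * ((u - 1) * C)) = (u - 1) * (- A) / ((u - 1) * (u * C))"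
        by (simp add: algebra_simps)
      also have "\<dots> = - A / (u * C)" using that by (intro mult_divide_mult_cancel_left) simp
      finally show ?thesis by (simp add: mult.commute)
    qed
    moreover have "w j \<noteq> 1" using w_ge[of j] by auto
    ultimately show ?thesis using d2[OF that] by simp
  qed
  \<comment> \<open>There are \<open>J + 3\<close> nodes, so degrees up to \<open>J + 1\<close> are
    annihilated. Multiplication by \<open>d 1\<close> gives the node \<open>1\<close> the
    coefficient \<open>1\<close>, which is the opposite of the sign used for the priors.\<close>
  have annihilate: "d 1 / d 0 * p (y 0) + p 1 - (\<Sum>j\<le>J. \<rho> j / w j * p (w j)) = 0"
    if p: "p = (\<lambda>v. \<Prod>(a, b)\<leftarrow>fs. a + b * v)" and "length fs \<le> J + 1" for fs p
  proof -
    have "0 = d 1 * (\<Sum>i\<le>J + 2. p (y i) / d i)"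
      using divided_difference_products_eq_0[of ?I y fs] y_inj that by (simp add: d_def)
    also have "\<dots> = (\<Sum>i\<le>J + 2. d 1 / d i * p (y i))"
      unfolding sum_distrib_left by simp
    also have "\<dots> = d 1 / d 0 * p (y 0) + p 1 + (\<Sum>j\<le>J. d 1 / d (j + 2) * p (w j))"
      unfolding split using d1_nz by (simp add: y_simps(1) y_Suc)
    also have "(\<Sum>j\<le>J. d 1 / d (j + 2) * p (w j)) = - (\<Sum>j\<le>J. \<rho> j / w j * p (w j))"
      unfolding sum_negf[symmetric] minus_mult_left by (intro sum.cong) (auto simp only: ratio atMost_iff)
    finally show ?thesis by simp
  qed
  have d0: "d 1 / d 0 = (\<Sum>j\<le>J. \<rho> j / w j) - 1"
    using annihilate[of _ "[]", OF refl] by simp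
  have match: "p 1 = (1 - (\<Sum>j\<le>J. \<rho> j / w j)) * p 0 + (\<Sum>j\<le>J. \<rho> j / w j * p (w j))"
    if "p = (\<lambda>v. \<Prod>(a, b)\<leftarrow>fs. a + b * v)" and "length fs \<le> J + 1" for fs p
    using annihilate[OF that] unfolding d0 y_simps(1) left_diff_distrib mult_1 by linarith

  have \<rho>0: "\<rho> 0 = (\<Prod>l\<in>{1..J}. 1 + 1 / (16 * (real l)\<^sup>2))"
  proof -
    have "{..J} - {0} = {1..J}" by auto
    then show ?thesis unfolding \<rho>_def by (auto intro!: prod.cong simp: field_simps)
  qed
  have \<rho>0_ge: "1 \<le> \<rho> 0" unfolding \<rho>0 by (intro prod_ge_1) auto
  have \<rho>0_le: "\<rho> 0 \<le> 6 / 5" unfolding \<rho>0 by (rule prod_1_plus_inverse_square_le) auto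
  \<comment> \<open>The factor for \<open>l = 0\<close> gives
    \<open>1 / 16 / (real j)\<^sup>2\<close> and the other factors together at most
    \<open>6 / 5 * 2\<close>. The decay in \<open>j\<close> bounds the total by a constant for every
    \<open>J\<close>.\<close>
  have \<rho>_le: "\<bar>\<rho> j\<bar> \<le> 3 / 20 * (1 / (real j)\<^sup>2)" if "1 \<le> j" "j \<le> J" for j
  proof -
    let ?S = "{1..J} - {j}"
    have "{..J} - {j} = insert 0 ?S" using that by auto
    then have "\<bar>\<rho> j\<bar> = 1 / 16 / (real j)\<^sup>2 *
        (\<Prod>l\<in>?S. (1 / 16 + (real l)\<^sup>2) / \<bar>(real l)\<^sup>2 - (real j)\<^sup>2\<bar>)"
      unfolding \<rho>_def by (simp add: abs_mult abs_prod)
    also have "(\<Prod>l\<in>?S. (1 / 16 + (real l)\<^sup>2) / \<bar>(real l)\<^sup>2 - (real j)\<^sup>2\<bar>) =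
        (\<Prod>l\<in>?S. 1 + 1 / (16 * (real l)\<^sup>2)) * (\<Prod>l\<in>?S. (real l)\<^sup>2 / \<bar>(real l)\<^sup>2 - (real j)\<^sup>2\<bar>)"
      unfolding prod.distrib[symmetric] by (intro prod.cong) (auto simp: field_simps)
    also have "\<dots> \<le> 6 / 5 * 2"
      by (intro mult_mono prod_1_plus_inverse_square_le[of _ J] prod_square_quotients_le_2 that)
         (auto intro!: prod_nonneg)
    finally show ?thesis by (simp add: mult_left_mono divide_right_mono)
  qed
  have \<rho>_sum: "(\<Sum>j\<in>{1..J}. \<bar>\<rho> j\<bar>) \<le> 3 / 10"
  proof -
    have "(\<Sum>j\<in>{1..J}. \<bar>\<rho> j\<bar>) \<le> (\<Sum>j\<in>{1..J}. 3 / 20 * (1 / (real j)\<^sup>2))"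
      by (intro sum_mono \<rho>_le) auto
    also have "\<dots> = 3 / 20 * (\<Sum>j\<in>{1..J}. 1 / (real j)\<^sup>2)" by (rule sum_distrib_left[symmetric])
    also have "\<dots> \<le> 3 / 20 * 2" by (intro mult_left_mono sum_inverse_squares_le_2) auto
    finally show ?thesis by simp
  qed
  have split0: "(\<Sum>j\<le>J. g j) = g 0 + (\<Sum>j\<in>{1..J}. g j)" for g :: "nat \<Rightarrow> real"
  proof -
    have "{..J} = insert 0 {1..J}" by auto
    then show ?thesis by simp
  qed
  define pos where "pos = (\<lambda>j. max (\<rho> j) 0)"
  define neg where "neg = (\<lambda>j. max (- \<rho> j) 0)"
  have pn: "\<rho> j = pos j - neg j" "0 \<le> pos j" "0 \<le> neg j" "pos j \<le> \<bar>\<rho> j\<bar>" "neg j \<le> \<bar>\<rho> j\<bar>" for j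
    by (auto simp: pos_def neg_def)
  have neg0: "neg 0 = 0" and pos0: "pos 0 = \<rho> 0" using \<rho>0_ge by (auto simp: neg_def pos_def)
  have neg_sum: "(\<Sum>j\<le>J. neg j) \<le> 3 / 10"
    unfolding split0 neg0 using sum_mono[of "{1..J}" neg "\<lambda>j. \<bar>\<rho> j\<bar>"] pn \<rho>_sum by force
  have pos_sum: "(\<Sum>j\<le>J. pos j) \<le> 3 / 2"
    unfolding split0 pos0 using sum_mono[of "{1..J}" pos "\<lambda>j. \<bar>\<rho> j\<bar>"] pn \<rho>_sum \<rho>0_le by force
  have over_w: "(\<Sum>j\<le>J. g j / w j) \<le> (\<Sum>j\<le>J. g j) / 121" if "\<And>j. 0 \<le> g j" for g :: "nat \<Rightarrow> real"
    unfolding sum_divide_distrib using that w_ge by (intro sum_mono divide_left_mono) (auto intro: less_le_trans[OF _ w_ge])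
  \<comment> \<open>The mass of the negative part. The positive part has the same mass, because the
    empty product is among the matched polynomials, so one constant normalises both priors.\<close>
  define Z where "Z = 1 + (\<Sum>j\<le>J. neg j / w j)"
  have w_pos: "0 < w j" "w j \<noteq> 0" for j using w_ge[of j] by auto
  have Z_ge: "1 \<le> Z"
    unfolding Z_def using pn w_pos by (auto intro!: sum_nonneg divide_nonneg_pos)
  have Z_le: "Z \<le> 13 / 10" using over_w[of neg] pn neg_sum by (auto simp: Z_def)
  \<comment> \<open>The smallest node \<open>121\<close> is chosen for this:
    \<open>3 / 2 / 121\<close> is just below \<open>1 / 80\<close>.\<close>
  have pos_w: "(\<Sum>j\<le>J. pos j / w j) \<le> 1 / 80" using over_w[of pos] pn pos_sum by auto
  have \<rho>_w: "(\<Sum>j\<le>J. \<rho> j / w j) = (\<Sum>j\<le>J. pos j / w j) - (\<Sum>j\<le>J. neg j / w j)"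
    by (simp add: pn(1) diff_divide_distrib sum_subtractf)
  have \<rho>_w': "(\<Sum>j\<le>J. \<rho> j / w j) \<le> 1 / 80"
    unfolding \<rho>_w using pos_w pn w_pos by (smt (verit) divide_nonneg_pos sum_nonneg)
  define \<mu>0 where "\<mu>0 = (\<lambda>i. (if i = 0 then 1 - (\<Sum>j\<le>J. \<rho> j / w j) else if i = 1 then 0 else pos (i - 2) / w (i - 2)) / Z)"
  define \<mu>1 where "\<mu>1 = (\<lambda>i. (if i = 0 then 0 else if i = 1 then 1 else neg (i - 2) / w (i - 2)) / Z)"
  have \<mu>0_simps: "\<mu>0 0 = (1 - (\<Sum>j\<le>J. \<rho> j / w j)) / Z" "\<mu>0 1 = 0" "\<mu>0 (j + 2) = pos j / w j / Z" for j
    by (auto simp: \<mu>0_def)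
  have \<mu>1_simps: "\<mu>1 0 = 0" "\<mu>1 1 = 1 / Z" "\<mu>1 (j + 2) = neg j / w j / Z" for j
    by (auto simp: \<mu>1_def)
  show thesis
  proof (rule that[of y \<mu>0 \<mu>1])
    show "0 \<le> y i" if "i \<le> J + 2" for i using w_pos by (auto simp: y_def intro: less_imp_le)
    show "y i \<le> 121 + 1920 * (real J)\<^sup>2" if "i \<le> J + 2" for i
    proof -
      have "w (i - 2) \<le> 121 + 1920 * (real J)\<^sup>2"
        unfolding w_def using that by (intro add_left_mono mult_left_mono power_mono) auto
      then show ?thesis by (auto simp: y_def)
    qed
    show "0 \<le> \<mu>0 i" for i
      unfolding \<mu>0_def using Z_ge \<rho>_w' pn w_pos by (auto intro!: divide_nonneg_pos)
    show "0 \<le> \<mu>1 i" for i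
      unfolding \<mu>1_def using Z_ge pn w_pos by (auto intro!: divide_nonneg_pos)
    have ZZ: "(1 + (\<Sum>j\<le>J. neg j / w j)) / Z = 1" using Z_ge by (simp add: Z_def)
    show "(\<Sum>i\<le>J + 2. \<mu>0 i) = 1"
      unfolding split \<mu>0_simps sum_divide_distrib[symmetric] \<rho>_w
      using ZZ by (simp add: add_divide_distrib diff_divide_distrib)
    show "(\<Sum>i\<le>J + 2. \<mu>1 i) = 1"
      unfolding split \<mu>1_simps sum_divide_distrib[symmetric]
      using ZZ by (simp add: add_divide_distrib)
    show "(\<Sum>i\<le>J + 2. \<mu>0 i * (\<Prod>(a, b)\<leftarrow>fs. a + b * y i)) =
       (\<Sum>i\<le>J + 2. \<mu>1 i * (\<Prod>(a, b)\<leftarrow>fs. a + b * y i))" if "length fs \<le> J + 1" for fs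
    proof -
      define p where "p = (\<lambda>v. \<Prod>(a, b)\<leftarrow>fs. a + b * v)"
      have a: "(\<Sum>j\<le>J. \<rho> j / w j * p (w j)) = (\<Sum>j\<le>J. pos j / w j * p (w j)) - (\<Sum>j\<le>J. neg j / w j * p (w j))"
        by (simp add: pn(1) diff_divide_distrib sum_subtractf left_diff_distrib)
      have b: "(\<Sum>j\<le>J. g j / Z * p (w j)) = (\<Sum>j\<le>J. g j * p (w j)) / Z" for g
        by (simp add: sum_divide_distrib)
      have "(\<Sum>i\<le>J + 2. \<mu>0 i * p (y i)) = (\<Sum>i\<le>J + 2. \<mu>1 i * p (y i))"
        unfolding split \<mu>0_simps \<mu>1_simps y_simps b using match[OF p_def that] a
        by (simp add: add_divide_distrib[symmetric])
      then show ?thesis by (simp add: p_def)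
    qed
    have "(\<Sum>i\<le>J + 2. \<mu>0 i * of_bool (y i \<noteq> 0)) = (\<Sum>j\<le>J. pos j / w j) / Z"
      unfolding split \<mu>0_simps y_simps sum_divide_distrib using w_pos by simp
    also have "\<dots> \<le> (\<Sum>j\<le>J. pos j / w j) / 1"
      using Z_ge pn w_pos by (intro divide_left_mono) (auto intro!: sum_nonneg divide_nonneg_pos)
    also have "\<dots> \<le> 1 / 80" using pos_w by simp
    finally show "(\<Sum>i\<le>J + 2. \<mu>0 i * of_bool (y i \<noteq> 0)) \<le> 1 / 80" .
    show "1 \<le> y i" if "i \<le> J + 2" "\<mu>1 i \<noteq> 0" for i
      using that w_ge[of "i - 2"] by (auto simp: \<mu>1_def y_def split: if_splits)
    have "(\<Sum>i\<le>J + 2. \<mu>1 i * y i) = (1 + (\<Sum>j\<le>J. neg j)) / Z"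
      unfolding split \<mu>1_simps y_simps using w_pos by (simp add: sum_divide_distrib add_divide_distrib)
    also have "\<dots> \<le> (1 + (\<Sum>j\<le>J. neg j)) / 1"
      using Z_ge pn by (intro divide_left_mono) (auto intro!: sum_nonneg add_nonneg_nonneg)
    also have "\<dots> \<le> 13 / 10" using neg_sum by simp
    finally show "(\<Sum>i\<le>J + 2. \<mu>1 i * y i) \<le> 13 / 10" .
    show "y 2 = 121" by (simp add: y_def w_def)
    \<comment> \<open>Each prior gets an atom of bounded weight contributing at least
      \<open>1 / 2\<close> to the mean. These atoms later ensure that enough draws are kept.\<close>
    have "1 / (13 / 10) \<le> \<rho> 0 / Z"
      using \<rho>0_ge Z_ge Z_le by (intro frac_le) auto
    then show "1 / 2 \<le> \<mu>0 2 * y 2"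
      using \<mu>0_simps(3)[of 0] y_simps(3)[of 0] w_pos[of 0] by (simp add: pos0 numeral_2_eq_2)
    show "y 1 = 1" by (simp add: y_def)
    show "1 / 2 \<le> \<mu>1 1 * y 1"
      unfolding \<mu>1_simps y_simps using Z_ge Z_le by (simp add: field_simps)
  qed
qed

section \<open>Thinned uniform samples\<close>

text \<open>An expectation over independent draws, written as a finite real sum so that it can be
  interchanged with averages over weight assignments.\<close>

definition iid_sum :: "'b set \<Rightarrow> ('b \<Rightarrow> real) \<Rightarrow> nat \<Rightarrow> ('b list \<Rightarrow> real) \<Rightarrow> real" where
  "iid_sum A d n F = (\<Sum>xs | set xs \<subseteq> A \<and> length xs = n. prod_list (map d xs) * F xs)"

lemma iid_sum_0 [simp]: "iid_sum A d 0 F = F []"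
proof -
  have "{xs. set xs \<subseteq> A \<and> length xs = 0} = {[]}" by auto
  then show ?thesis unfolding iid_sum_def by simp
qed

lemma iid_sum_Suc: "iid_sum A d (Suc n) F = (\<Sum>a\<in>A. d a * iid_sum A d n (\<lambda>xs. F (a # xs)))"
proof -
  let ?X = "{xs. set xs \<subseteq> A \<and> length xs = n}"
  have "iid_sum A d (Suc n) F = (\<Sum>(xs, a)\<in>?X \<times> A. prod_list (map d (a # xs)) * F (a # xs))"
    unfolding iid_sum_def lists_length_Suc_eq
    by (subst sum.reindex) (auto simp: inj_on_def case_prod_unfold)
  also have "\<dots> = (\<Sum>a\<in>A. \<Sum>xs\<in>?X. prod_list (map d (a # xs)) * F (a # xs))"
    unfolding sum.cartesian_product[symmetric] by (rule sum.swap)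
  finally show ?thesis by (simp add: iid_sum_def sum_distrib_left mult.assoc)
qed

lemma iid_sum_bounds:
  assumes "finite A" "\<And>a. a \<in> A \<Longrightarrow> 0 \<le> d a" "sum d A = 1"
    and "\<And>xs. 0 \<le> F xs" "\<And>xs. F xs \<le> 1"
  shows "0 \<le> iid_sum A d n F" "iid_sum A d n F \<le> 1"
proof -
  have "0 \<le> iid_sum A d n F \<and> iid_sum A d n F \<le> 1"
    using assms(4,5)
  proof (induction n arbitrary: F)
    case (Suc n)
    then have *: "0 \<le> iid_sum A d n (\<lambda>xs. F (a # xs)) \<and> iid_sum A d n (\<lambda>xs. F (a # xs)) \<le> 1" for a by simp
    then have "(\<Sum>a\<in>A. d a * iid_sum A d n (\<lambda>xs. F (a # xs))) \<le> (\<Sum>a\<in>A. d a)"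
      using assms(2) by (intro sum_mono) (simp add: mult_left_le)
    moreover have "0 \<le> (\<Sum>a\<in>A. d a * iid_sum A d n (\<lambda>xs. F (a # xs)))"
      using * assms(2) by (intro sum_nonneg) simp
    ultimately show ?case using assms(3) by (simp add: iid_sum_Suc)
  qed simp
  then show "0 \<le> iid_sum A d n F" "iid_sum A d n F \<le> 1" by auto
qed

lemma iid_sum_const:
  assumes "sum d A = 1"
  shows "iid_sum A d n (\<lambda>_. c) = c"
  using assms by (induction n) (simp_all add: iid_sum_Suc sum_distrib_right[symmetric])

lemma iid_sum_prod_list:
  "iid_sum A d n (\<lambda>xs. prod_list (map h xs)) = (\<Sum>a\<in>A. d a * h a) ^ n"
proof (induction n)
  case (Suc n)
  have mult: "iid_sum A d n (\<lambda>xs. c * F xs) = c * iid_sum A d n F" for c F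
    by (simp add: iid_sum_def sum_distrib_left mult_ac)
  show ?case using Suc by (simp add: iid_sum_Suc mult sum_distrib_right mult.assoc)
qed simp

text \<open>The value \<open>0\<close> stands for a failure: fewer than \<open>q\<close> sample points were kept.\<close>

definition kept :: "nat \<Rightarrow> ('a list \<Rightarrow> real) \<Rightarrow> ('a \<times> bool) list \<Rightarrow> real" where
  "kept q F ys = (let xs = map fst (filter snd ys) in if length xs < q then 0 else F (take q xs))"

lemma kept_simps:
  "kept 0 F ys = F []"
  "kept (Suc q) F [] = 0"
  "kept q F ((x, False) # ys) = kept q F ys"
  "kept (Suc q) F ((x, True) # ys) = kept q (\<lambda>xs. F (x # xs)) ys"
  by (simp_all add: kept_def Let_def)

lemma kept_bounds:
  assumes "\<And>xs. 0 \<le> F xs" "\<And>xs. F xs \<le> (1::real)"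
  shows "0 \<le> kept q F ys" "kept q F ys \<le> 1"
  using assms by (simp_all add: kept_def Let_def)

text \<open>Given that it is kept, a draw has law \<open>D\<close>, so the error comes only from
  keeping fewer than \<open>q\<close> of \<open>Q\<close> draws. By Markov's inequality this has
  probability at most \<open>2 ^ q\<close> times the expectation of \<open>1 / 2\<close> to the
  number of kept draws, which is \<open>(1 - p / 2) ^ Q\<close>. The induction removes one draw at a
  time.\<close>

lemma thinning_error:
  assumes P: "finite P" "\<And>x. x \<in> P \<Longrightarrow> 0 \<le> D x" "sum D P = 1" and p: "0 \<le> p" "p \<le> (1::real)"
    and e_True: "\<And>x. x \<in> P \<Longrightarrow> e (x, True) = p * D x"
    and e_False: "\<And>x. x \<in> P \<Longrightarrow> 0 \<le> e (x, False)" "(\<Sum>x\<in>P. e (x, False)) = 1 - p"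
    and F: "\<And>xs. 0 \<le> F xs" "\<And>xs. F xs \<le> 1"
  shows "\<bar>iid_sum (P \<times> UNIV) e Q (kept q F) - iid_sum P D q F\<bar> \<le> 2 ^ q * (1 - p / 2) ^ Q"
  using F
proof (induction Q arbitrary: q F)
  case 0
  show ?case
  proof (cases q)
    case (Suc r)
    have "0 \<le> iid_sum P D q F" "iid_sum P D q F \<le> 1"
      using iid_sum_bounds[of P D F q] P 0 by simp_all
    moreover have "iid_sum P D q F \<le> 2 ^ q"
      by (rule order_trans[OF \<open>iid_sum P D q F \<le> 1\<close>]) simp
    ultimately show ?thesis by (simp add: Suc kept_simps del: power_Suc)
  qed (simp add: kept_simps)
next
  case (Suc Q)
  have split: "(\<Sum>z\<in>P \<times> UNIV. g z) = (\<Sum>x\<in>P. g (x, False)) + (\<Sum>x\<in>P. g (x, True))" for g :: "'a \<times> bool \<Rightarrow> real"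
  proof -
    have "(\<Sum>z\<in>P \<times> UNIV. g z) = (\<Sum>x\<in>P. \<Sum>u\<in>UNIV. g (x, u))"
      by (simp add: sum.cartesian_product)
    then show ?thesis by (simp add: UNIV_bool sum.distrib)
  qed
  show ?case
  proof (cases q)
    case 0
    have "sum e (P \<times> UNIV) = 1"
      unfolding split using P e_False by (simp add: e_True sum_distrib_left[symmetric])
    then have "iid_sum (P \<times> UNIV) e (Suc Q) (kept q F) = F []"
      by (simp add: 0 kept_simps(1)[abs_def] iid_sum_const)
    then show ?thesis using p by (simp add: 0 del: power_Suc)
  next
    case (Suc r)
    \<comment> \<open>The bound after one discarded draw. A kept draw lowers \<open>q\<close> by one
      and halves it, whence the factor \<open>(1 - p) + p / 2 = 1 - p / 2\<close>.\<close>
    define R where "R = (2::real) ^ q * (1 - p / 2) ^ Q"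
    let ?A = "iid_sum (P \<times> UNIV) e Q"
    let ?Fx = "\<lambda>x xs. F (x # xs)"
    have R: "2 ^ r * (1 - p / 2) ^ Q = R / 2" by (simp add: R_def Suc)
    have 1: "\<bar>?A (kept q F) - iid_sum P D q F\<bar> \<le> R"
      unfolding R_def by (rule Suc.IH) (use Suc.prems in auto)
    have 2: "\<bar>?A (kept r (?Fx x)) - iid_sum P D r (?Fx x)\<bar> \<le> R / 2" for x
      unfolding R[symmetric] by (rule Suc.IH) (use Suc.prems in auto)
    have "iid_sum (P \<times> UNIV) e (Suc Q) (kept q F) =
        (1 - p) * ?A (kept q F) + (\<Sum>x\<in>P. p * D x * ?A (kept r (?Fx x)))"
      unfolding iid_sum_Suc split using e_False(2)
      by (simp add: Suc kept_simps(3,4) e_True sum_distrib_right[symmetric] del: iid_sum_Suc)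
    moreover have "iid_sum P D q F = (1 - p) * iid_sum P D q F + (\<Sum>x\<in>P. p * D x * iid_sum P D r (?Fx x))"
    proof -
      have "(\<Sum>x\<in>P. p * D x * iid_sum P D r (?Fx x)) = p * iid_sum P D q F"
        by (simp add: Suc iid_sum_Suc sum_distrib_left mult.assoc)
      then show ?thesis by (simp add: left_diff_distrib)
    qed
    ultimately have "iid_sum (P \<times> UNIV) e (Suc Q) (kept q F) - iid_sum P D q F =
        (1 - p) * (?A (kept q F) - iid_sum P D q F) +
        (\<Sum>x\<in>P. p * D x * (?A (kept r (?Fx x)) - iid_sum P D r (?Fx x)))"
      by (simp add: right_diff_distrib sum_subtractf)
    also have "\<bar>\<dots>\<bar> \<le> (1 - p) * R + (\<Sum>x\<in>P. p * D x * (R / 2))"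
    proof (rule abs_triangle_ineq[THEN order_trans], rule add_mono)
      show "\<bar>(1 - p) * (?A (kept q F) - iid_sum P D q F)\<bar> \<le> (1 - p) * R"
        using 1 p by (simp add: abs_mult mult_left_mono)
      show "\<bar>\<Sum>x\<in>P. p * D x * (?A (kept r (?Fx x)) - iid_sum P D r (?Fx x))\<bar> \<le> (\<Sum>x\<in>P. p * D x * (R / 2))"
      proof (rule sum_abs[THEN order_trans], rule sum_mono)
        fix x assume x: "x \<in> P"
        have "\<bar>p * D x * (?A (kept r (?Fx x)) - iid_sum P D r (?Fx x))\<bar> =
            p * D x * \<bar>?A (kept r (?Fx x)) - iid_sum P D r (?Fx x)\<bar>"
          using p P x by (simp add: abs_mult)
        also have "\<dots> \<le> p * D x * (R / 2)"
          using p P x by (intro mult_left_mono 2) simp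
        finally show "\<bar>p * D x * (?A (kept r (?Fx x)) - iid_sum P D r (?Fx x))\<bar> \<le> p * D x * (R / 2)" .
      qed
    qed
    also have "(\<Sum>x\<in>P. p * D x * (R / 2)) = p * (R / 2)"
      using P(3) by (simp add: sum_distrib_left[symmetric] sum_distrib_right[symmetric] flip: sum_divide_distrib)
    also have "(1 - p) * R + p * (R / 2) = 2 ^ q * (1 - p / 2) ^ Suc Q"
      by (simp add: R_def algebra_simps)
    finally show ?thesis .
  qed
qed

section \<open>Mixtures over independent weights on the points\<close>

lemma prod_list_group_by_fst:
  fixes g :: "'a \<Rightarrow> 'b \<Rightarrow> real"
  assumes "finite P" "fst ` set ys \<subseteq> P"
  shows "prod_list (map (\<lambda>(x, u). g x u) ys) =
    (\<Prod>x\<in>P. prod_list (map (\<lambda>z. g x (snd z)) (filter (\<lambda>z. fst z = x) ys)))"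
  using assms(2)
proof (induction ys)
  case (Cons z ys)
  obtain x u where z: "z = (x, u)" by fastforce
  have "(\<Prod>x'\<in>P. prod_list (map (\<lambda>z. g x' (snd z)) (filter (\<lambda>z. fst z = x') (z # ys)))) =
      (\<Prod>x'\<in>P. (if x' = x then g x' u else 1) * prod_list (map (\<lambda>z. g x' (snd z)) (filter (\<lambda>z. fst z = x') ys)))"
    by (intro prod.cong) (auto simp: z)
  also have "\<dots> = g x u * (\<Prod>x'\<in>P. prod_list (map (\<lambda>z. g x' (snd z)) (filter (\<lambda>z. fst z = x') ys)))"
    using Cons.prems assms(1) by (simp add: prod.distrib z)
  finally show ?case using Cons by (simp add: z)
qed simp

lemma sum_PiE_prod:
  fixes g :: "'a \<Rightarrow> 'b \<Rightarrow> real"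
  assumes "finite P" "finite I"
  shows "(\<Sum>w\<in>P \<rightarrow>\<^sub>E I. \<Prod>x\<in>P. g x (w x)) = (\<Prod>x\<in>P. \<Sum>i\<in>I. g x i)"
  using assms by (simp add: prod_sum_PiE)

lemma sum_PiE_weight:
  fixes \<mu> :: "'b \<Rightarrow> real"
  assumes "finite P" "finite I" "sum \<mu> I = 1"
  shows "(\<Sum>w\<in>P \<rightarrow>\<^sub>E I. \<Prod>x\<in>P. \<mu> (w x)) = 1"
  using sum_PiE_prod[OF assms(1,2), of "\<lambda>_. \<mu>"] assms(3) by simp

lemma sum_PiE_marginal:
  fixes \<mu> :: "'b \<Rightarrow> real"
  assumes "finite P" "finite I" "sum \<mu> I = 1" "x \<in> P"
  shows "(\<Sum>w\<in>P \<rightarrow>\<^sub>E I. (\<Prod>x\<in>P. \<mu> (w x)) * h (w x)) = (\<Sum>i\<in>I. \<mu> i * h i)"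
proof -
  have "(\<Sum>w\<in>P \<rightarrow>\<^sub>E I. (\<Prod>x\<in>P. \<mu> (w x)) * h (w x)) =
      (\<Sum>w\<in>P \<rightarrow>\<^sub>E I. \<Prod>z\<in>P. \<mu> (w z) * (if z = x then h (w z) else 1))"
    using assms by (simp add: prod.distrib)
  also have "\<dots> = (\<Prod>z\<in>P. \<Sum>i\<in>I. \<mu> i * (if z = x then h i else 1))"
    by (rule sum_PiE_prod[OF assms(1,2)])
  also have "\<dots> = (\<Prod>z\<in>P. if z = x then (\<Sum>i\<in>I. \<mu> i * h i) else 1)"
    using assms(3) by (intro prod.cong) auto
  finally show ?thesis using assms by simp
qed

text \<open>A uniform \<open>x\<close> of the \<open>N\<close> points, kept with probability proportional to its weight.\<close>

definition thinned :: "real \<Rightarrow> nat \<Rightarrow> ('i \<Rightarrow> real) \<Rightarrow> ('a \<Rightarrow> 'i) \<Rightarrow> 'a \<times> bool \<Rightarrow> real" where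
  "thinned W N y w = (\<lambda>(x, u). (if u then y (w x) / W else 1 - y (w x) / W) / N)"

text \<open>
  Given the drawn points, the likelihood of the kept marks is for each point a polynomial in its
  weight, of degree the multiplicity of the point. Hence both priors give the same likelihood
  unless some multiplicity exceeds \<open>L\<close>, which is bounded by an exponential moment.
\<close>

lemma mixtures_close:
  fixes y :: "'i \<Rightarrow> real" and P :: "'a set"
  assumes P: "finite P" "card P = N" "0 < N" and I: "finite I"
    and W: "0 < W" and y: "\<And>i. i \<in> I \<Longrightarrow> 0 \<le> y i" "\<And>i. i \<in> I \<Longrightarrow> y i \<le> W"
    and \<mu>: "\<And>i. 0 \<le> \<mu>0 i" "\<And>i. 0 \<le> \<mu>1 i" "sum \<mu>0 I = 1"
    and match: "\<And>fs. length fs \<le> L \<Longrightarrow>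
       (\<Sum>i\<in>I. \<mu>0 i * (\<Prod>(a, b)\<leftarrow>fs. a + b * y i)) = (\<Sum>i\<in>I. \<mu>1 i * (\<Prod>(a, b)\<leftarrow>fs. a + b * y i))"
    and \<Phi>: "\<And>ys. 0 \<le> \<Phi> ys" "\<And>ys. \<Phi> ys \<le> 1"
  shows "(\<Sum>w\<in>P \<rightarrow>\<^sub>E I. (\<Prod>x\<in>P. \<mu>0 (w x)) * iid_sum (P \<times> UNIV) (thinned W N y w) Q \<Phi>) \<le>
     (\<Sum>w\<in>P \<rightarrow>\<^sub>E I. (\<Prod>x\<in>P. \<mu>1 (w x)) * iid_sum (P \<times> UNIV) (thinned W N y w) Q \<Phi>) +
     N * (1 + 1 / N) ^ Q / 2 ^ (L + 1)"
proof -
  let ?Y = "{ys. set ys \<subseteq> P \<times> (UNIV :: bool set) \<and> length ys = Q}"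
  let ?e = "thinned W N y"
  have finY: "finite ?Y" by (rule finite_lists_length_eq) (use P in auto)
  have e_nonneg: "0 \<le> ?e w z" if "w \<in> P \<rightarrow>\<^sub>E I" "z \<in> P \<times> UNIV" for w z
  proof -
    have "w (fst z) \<in> I" using that by auto
    then show ?thesis using y W by (auto simp: thinned_def case_prod_unfold)
  qed
  define m where "m = (\<lambda>\<mu> ys. \<Sum>w\<in>P \<rightarrow>\<^sub>E I. (\<Prod>x\<in>P. \<mu> (w x)) * prod_list (map (?e w) ys))"
  have swap: "(\<Sum>w\<in>P \<rightarrow>\<^sub>E I. (\<Prod>x\<in>P. \<mu> (w x)) * iid_sum (P \<times> UNIV) (?e w) Q \<Psi>) = (\<Sum>ys\<in>?Y. m \<mu> ys * \<Psi> ys)"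
    for \<mu> \<Psi>
    unfolding iid_sum_def m_def sum_distrib_left sum_distrib_right
    by (subst sum.swap) (simp add: mult.assoc)
  have e_list: "0 \<le> prod_list (map (?e w) ys)" if "w \<in> P \<rightarrow>\<^sub>E I" "ys \<in> ?Y" for w ys
    using e_nonneg[OF that(1)] that(2) by (intro prod_list_nonneg) auto
  have m0_nonneg: "0 \<le> m \<mu>0 ys" and m1_nonneg: "0 \<le> m \<mu>1 ys" if "ys \<in> ?Y" for ys
    unfolding m_def using that e_list \<mu>
    by (auto intro!: sum_nonneg mult_nonneg_nonneg prod_nonneg)
  have m_factor: "m \<mu> ys = (1 / N) ^ Q * (\<Prod>x\<in>P. \<Sum>i\<in>I. \<mu> i *
      (\<Prod>(a, b)\<leftarrow>map (\<lambda>z. if snd z then (0, 1 / W) else (1, - 1 / W)) (filter (\<lambda>z. fst z = x) ys). a + b * y i))"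
    if "ys \<in> ?Y" for \<mu> ys
  proof -
    define b where "b = (\<lambda>i u. if u then y i / W else 1 - y i / W)"
    have lin: "map (\<lambda>z. b i (snd z)) zs =
        map (\<lambda>(a, b). a + b * y i) (map (\<lambda>z. if snd z then (0, 1 / W) else (1, - 1 / W)) zs)"
      for i and zs :: "('a \<times> bool) list"
      by (auto simp: b_def)
    have "prod_list (map (?e w) ys) = (1 / N) ^ Q * (\<Prod>x\<in>P. prod_list (map (\<lambda>z. b (w x) (snd z)) (filter (\<lambda>z. fst z = x) ys)))" for w
    proof -
      have "prod_list (map (?e w) ys) = (1 / N) ^ length ys * prod_list (map (\<lambda>(x, u). b (w x) u) ys)"
        by (induction ys) (auto simp: thinned_def b_def)
      also have "prod_list (map (\<lambda>(x, u). b (w x) u) ys) =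
         (\<Prod>x\<in>P. prod_list (map (\<lambda>z. b (w x) (snd z)) (filter (\<lambda>z. fst z = x) ys)))"
        using that P by (intro prod_list_group_by_fst) auto
      finally show ?thesis using that by simp
    qed
    then have "m \<mu> ys = (1 / N) ^ Q * (\<Sum>w\<in>P \<rightarrow>\<^sub>E I. \<Prod>x\<in>P. \<mu> (w x) *
        prod_list (map (\<lambda>z. b (w x) (snd z)) (filter (\<lambda>z. fst z = x) ys)))"
      by (simp add: m_def prod.distrib sum_distrib_left mult_ac)
    also have "\<dots> = (1 / N) ^ Q * (\<Prod>x\<in>P. \<Sum>i\<in>I. \<mu> i *
        prod_list (map (\<lambda>z. b i (snd z)) (filter (\<lambda>z. fst z = x) ys)))"
      by (subst sum_PiE_prod[OF P(1) I]) simp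
    finally show ?thesis by (simp only: lin)
  qed
  define cnt where "cnt = (\<lambda>x (ys :: ('a \<times> bool) list). length (filter (\<lambda>z. fst z = x) ys))"
  \<comment> \<open>If some multiplicity exceeds \<open>L\<close>, its summand is at least
    \<open>1\<close> and pays for the whole term on the left.\<close>
  have pointwise: "m \<mu>0 ys * \<Phi> ys \<le> m \<mu>1 ys * \<Phi> ys + m \<mu>0 ys * (\<Sum>x\<in>P. 2 ^ cnt x ys / 2 ^ (L + 1))"
    if ys: "ys \<in> ?Y" for ys
  proof (cases "\<forall>x\<in>P. cnt x ys \<le> L")
    case True
    have "m \<mu>0 ys = m \<mu>1 ys"
      unfolding m_factor[OF ys] using True by (intro arg_cong2[where f = "(*)"] prod.cong match) (auto simp: cnt_def)
    moreover have "0 \<le> m \<mu>0 ys * (\<Sum>x\<in>P. 2 ^ cnt x ys / 2 ^ (L + 1))"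
      using m0_nonneg[OF ys] by (intro mult_nonneg_nonneg sum_nonneg) auto
    ultimately show ?thesis by simp
  next
    case False
    then obtain x where x: "x \<in> P" "L + 1 \<le> cnt x ys" by force
    have "(2::real) ^ (L + 1) \<le> 2 ^ cnt x ys" using x by (intro power_increasing) auto
    then have "1 \<le> 2 ^ cnt x ys / (2::real) ^ (L + 1)" by simp
    also have "\<dots> \<le> (\<Sum>x\<in>P. 2 ^ cnt x ys / 2 ^ (L + 1))"
      using x P by (intro member_le_sum) auto
    finally have "m \<mu>0 ys * \<Phi> ys \<le> m \<mu>0 ys * (\<Sum>x\<in>P. 2 ^ cnt x ys / 2 ^ (L + 1))"
      using m0_nonneg[OF ys] \<Phi> by (intro mult_left_mono) (auto intro: order_trans)
    moreover have "0 \<le> m \<mu>1 ys * \<Phi> ys" using m1_nonneg[OF ys] \<Phi> by simp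
    ultimately show ?thesis by simp
  qed
  have count: "(\<Sum>ys\<in>?Y. m \<mu>0 ys * 2 ^ cnt x ys) = (1 + 1 / N) ^ Q" if x: "x \<in> P" for x
  proof -
    define h where "h = (\<lambda>z :: 'a \<times> bool. if fst z = x then 2 else 1 :: real)"
    \<comment> \<open>The two marks of a point have total probability \<open>1 / N\<close> whatever
      its weight, so the multiplicities have the same law for every \<open>w\<close>.\<close>
    have mass: "(\<Sum>z\<in>P \<times> UNIV. ?e w z * h z) = 1 + 1 / N" for w
    proof -
      have "(\<Sum>z\<in>P \<times> UNIV. ?e w z * h z) = (\<Sum>x'\<in>P. \<Sum>u\<in>UNIV. ?e w (x', u) * h (x', u))"
        by (simp add: sum.cartesian_product)
      also have "\<dots> = (\<Sum>x'\<in>P. 1 / N + (if x' = x then 1 / N else 0))"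
        by (intro sum.cong) (auto simp: UNIV_bool thinned_def h_def add_divide_distrib diff_divide_distrib)
      also have "\<dots> = 1 + 1 / N" using P x by (simp add: sum.distrib)
      finally show ?thesis .
    qed
    have "2 ^ cnt x ys = prod_list (map h ys)" for ys
      by (induction ys) (auto simp: cnt_def h_def)
    then have "(\<Sum>ys\<in>?Y. m \<mu>0 ys * 2 ^ cnt x ys) =
       (\<Sum>w\<in>P \<rightarrow>\<^sub>E I. (\<Prod>x\<in>P. \<mu>0 (w x)) * (\<Sum>z\<in>P \<times> UNIV. ?e w z * h z) ^ Q)"
      by (simp add: swap[symmetric] iid_sum_prod_list)
    then show ?thesis
      by (simp only: mass sum_distrib_right[symmetric] sum_PiE_weight[OF P(1) I \<mu>(3)] mult_1)
  qed
  have "(\<Sum>ys\<in>?Y. m \<mu>0 ys * \<Phi> ys) \<le> (\<Sum>ys\<in>?Y. m \<mu>1 ys * \<Phi> ys + m \<mu>0 ys * (\<Sum>x\<in>P. 2 ^ cnt x ys / 2 ^ (L + 1)))"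
    by (intro sum_mono pointwise)
  also have "\<dots> = (\<Sum>ys\<in>?Y. m \<mu>1 ys * \<Phi> ys) + (\<Sum>x\<in>P. (\<Sum>ys\<in>?Y. m \<mu>0 ys * 2 ^ cnt x ys) / 2 ^ (L + 1))"
    unfolding sum.distrib sum_distrib_left sum_divide_distrib
    by (subst (2) sum.swap) simp
  also have "(\<Sum>x\<in>P. (\<Sum>ys\<in>?Y. m \<mu>0 ys * 2 ^ cnt x ys) / 2 ^ (L + 1)) = N * (1 + 1 / N) ^ Q / 2 ^ (L + 1)"
    using P by (simp add: count)
  finally show ?thesis unfolding swap .
qed

section \<open>Sample bound for telling small support from spread support\<close>

lemma exp_uminus_le_half:
  fixes u :: real
  assumes "0 \<le> u" "u \<le> 1"
  shows "exp (- u) \<le> 1 - u / 2"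
proof -
  have "1 \<le> (1 - u / 2) * (1 + u)"
    using assms mult_left_le[of u u] by (simp add: algebra_simps)
  also have "\<dots> \<le> (1 - u / 2) * exp u"
    using assms by (intro mult_left_mono exp_ge_add_one_self) auto
  finally show ?thesis by (simp add: exp_minus field_simps)
qed

text \<open>Averaged over the priors, acceptance is at least \<open>3 / 5\<close> for mostly zero
  weights and at most \<open>13 / 30\<close> for weights at least \<open>1\<close>. Thinning costs
  \<open>1 / 16\<close> under each prior and exchanging the priors \<open>1 / 100\<close>, in total
  less than the gap \<open>1 / 6\<close>. The \<open>13\<close> in \<open>spread\<close> is a Markov
  threshold for total weights of mean at most \<open>13 / 10\<close> per point.\<close>

lemma few_or_spread_sample_bound:
  fixes P :: "'a set" and F :: "'a list \<Rightarrow> real"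
  assumes P: "finite P" "card P = 2 ^ s" and k: "1 \<le> k" "2 ^ s \<le> 8 * k"
    and F: "\<And>xs. 0 \<le> F xs" "\<And>xs. F xs \<le> 1"
    and few: "\<And>D. (\<And>x. x \<in> P \<Longrightarrow> 0 \<le> D x) \<Longrightarrow> sum D P = 1 \<Longrightarrow>
       card {x \<in> P. D x \<noteq> 0} \<le> k \<Longrightarrow> 2 / 3 \<le> iid_sum P D q F"
    and spread: "\<And>D. (\<And>x. x \<in> P \<Longrightarrow> 1 / (13 * 2 ^ s) \<le> D x) \<Longrightarrow> sum D P = 1 \<Longrightarrow>
       iid_sum P D q F \<le> 1 / 3"
  shows "2 ^ s / (8000000 * real s) \<le> real q"
proof (rule ccontr)
  assume "\<not> ?thesis"
  then have small: "real q < 2 ^ s / (8000000 * real s)" by simp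
  define N :: nat where "N = 2 ^ s"
  have N: "card P = N" "0 < N" "real N = 2 ^ s" using P by (auto simp: N_def)
  obtain x0 where x0: "x0 \<in> P" using N by (metis card.empty ex_in_conv less_irrefl)
  have "q \<noteq> 0"
  proof
    assume "q = 0"
    have "card {x \<in> P. of_bool (x = x0) \<noteq> (0::real)} \<le> k"
    proof -
      have "{x \<in> P. of_bool (x = x0) \<noteq> (0::real)} = {x0}" using x0 by auto
      then show ?thesis using k by simp
    qed
    then have "2 / 3 \<le> F []"
      using few[of "\<lambda>x. of_bool (x = x0)"] P x0 \<open>q = 0\<close> by simp
    moreover have "F [] \<le> 1 / 3"
      using spread[of "\<lambda>x. 1 / N"] P N \<open>q = 0\<close> by (simp add: field_simps)
    ultimately show False by simp
  qed
  have "s \<noteq> 0" using small by (cases "s = 0") auto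
  \<comment> \<open>From \<open>q + 4 \<le> 5 * q\<close>. The summand \<open>4\<close> becomes the
    factor \<open>exp (- 4)\<close> in the thinning error.\<close>
  have q4: "real q + 4 < 2 ^ s / (1600000 * real s)"
    using small \<open>q \<noteq> 0\<close> by simp
  have s10: "10 \<le> s"
  proof (rule ccontr)
    assume "\<not> 10 \<le> s"
    then have "(2::real) ^ s \<le> 2 ^ 10" by (intro power_increasing) auto
    moreover have "4 < (2::real) ^ s / (1600000 * real s)" using q4 by linarith
    ultimately show False using \<open>s \<noteq> 0\<close> by (simp add: field_simps)
  qed

  \<comment> \<open>Products of up to \<open>J + 1 = 2 * s\<close> factors are matched, so the
    exponential moment is divided by \<open>2 ^ (2 * s + 1)\<close>, against only
    \<open>2 ^ s\<close> points.\<close>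
  define J where "J = 2 * s - 1"
  obtain y \<mu>0 \<mu>1 :: "nat \<Rightarrow> real" where y: "\<And>i. i \<le> J + 2 \<Longrightarrow> 0 \<le> y i"
    "\<And>i. i \<le> J + 2 \<Longrightarrow> y i \<le> 121 + 1920 * (real J)\<^sup>2"
    and \<mu>: "\<And>i. 0 \<le> \<mu>0 i" "\<And>i. 0 \<le> \<mu>1 i"
    "(\<Sum>i\<le>J + 2. \<mu>0 i) = 1" "(\<Sum>i\<le>J + 2. \<mu>1 i) = 1"
    and match: "\<And>fs. length fs \<le> J + 1 \<Longrightarrow>
       (\<Sum>i\<le>J + 2. \<mu>0 i * (\<Prod>(a, b)\<leftarrow>fs. a + b * y i)) =
       (\<Sum>i\<le>J + 2. \<mu>1 i * (\<Prod>(a, b)\<leftarrow>fs. a + b * y i))"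
    and mostly_0: "(\<Sum>i\<le>J + 2. \<mu>0 i * of_bool (y i \<noteq> 0)) \<le> 1 / 80"
    and ge_1: "\<And>i. i \<le> J + 2 \<Longrightarrow> \<mu>1 i \<noteq> 0 \<Longrightarrow> 1 \<le> y i"
    and mean: "(\<Sum>i\<le>J + 2. \<mu>1 i * y i) \<le> 13 / 10"
    and atoms: "y 2 = 121" "1 / 2 \<le> \<mu>0 2 * y 2" "y 1 = 1" "1 / 2 \<le> \<mu>1 1 * y 1"
    by (rule moment_matching_priors[of J]) (rule that)
  define I where "I = {..J + 2}"
  \<comment> \<open>\<open>W\<close> bounds all weights, so that \<open>y i / W\<close> is a
    probability; it has order \<open>s\<^sup>2\<close>. The number \<open>Q\<close> of uniform draws
    is about \<open>N * s / 10\<close>, few enough for multiplicities above \<open>2 * s\<close> to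
    be rare.\<close>
  define W where "W = 121 + 1920 * (real J)\<^sup>2"
  define Q where "Q = 2 ^ s * s div 10"
  have I: "finite I" "\<And>i. i \<in> I \<longleftrightarrow> i \<le> J + 2" by (auto simp: I_def)
  have W_pos: "0 < W" by (simp add: W_def add_pos_nonneg)
  have W_le: "W \<le> 10000 * (real s)\<^sup>2"
  proof -
    have "(real J)\<^sup>2 \<le> (2 * real s)\<^sup>2" unfolding J_def by (intro power_mono) auto
    moreover have "1 \<le> (real s)\<^sup>2" using s10 by (simp add: one_le_power)
    ultimately show ?thesis unfolding W_def by (simp add: power_mult_distrib)
  qed
  have W_ge: "1920 * real s \<le> W"
  proof -
    have "real s \<le> real J" using s10 by (simp add: J_def)
    also have "\<dots> \<le> (real J)\<^sup>2" by (cases "J = 0") (auto simp: power2_eq_square)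
    finally show ?thesis unfolding W_def by linarith
  qed
  have Q_div: "10 * Q \<le> 2 ^ s * s" "2 ^ s * s \<le> 10 * Q + 10"
    unfolding Q_def by presburger+
  have Q_real: "10 * real Q \<le> N * real s" "N * real s \<le> 10 * real Q + 10"
    using of_nat_mono[OF Q_div(1), where 'a = real] of_nat_mono[OF Q_div(2), where 'a = real]
    by (simp_all add: N)
  have Q_le: "real Q \<le> N * real s / 10" using Q_real by simp
  have Q_ge: "N * real s / 20 \<le> real Q"
  proof -
    have "(2::real) ^ 1 \<le> 2 ^ s" using s10 by (intro power_increasing) auto
    then have "2 * 10 \<le> N * real s" unfolding N using s10 by (intro mult_mono) auto
    then show ?thesis using Q_real by simp
  qed

  define \<Omega> where "\<Omega> = P \<rightarrow>\<^sub>E I"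
  define E where "E = (\<lambda>(\<mu> :: nat \<Rightarrow> real) \<phi>. \<Sum>w\<in>\<Omega>. (\<Prod>x\<in>P. \<mu> (w x)) * \<phi> w)"
  define S where "S = (\<lambda>w. \<Sum>x\<in>P. y (w x))"
  \<comment> \<open>If all weights vanish there is nothing to normalise; a point mass keeps
    \<open>D w\<close> a distribution with small support.\<close>
  define D where "D = (\<lambda>w x. if S w = 0 then of_bool (x = x0) else y (w x) / S w)"
  define g where "g = (\<lambda>w. iid_sum P (D w) q F)"
  define h where "h = (\<lambda>w. iid_sum (P \<times> UNIV) (thinned W N y w) Q (kept q F))"
  \<comment> \<open>The bound \<open>2 ^ q * (1 - p / 2) ^ Q\<close> with
    \<open>p = S w / (N * W)\<close>, relaxed to an exponential so that its mean factorises over the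
    points.\<close>
  define err where "err = (\<lambda>w. 2 ^ q * (\<Prod>x\<in>P. exp (- (Q / (2 * N * W)) * y (w x))))"
  have wI: "w x \<in> I" if "w \<in> \<Omega>" "x \<in> P" for w x using that by (auto simp: \<Omega>_def)
  have y_w: "0 \<le> y (w x)" "y (w x) \<le> W" if "w \<in> \<Omega>" "x \<in> P" for w x
    using y[of "w x"] wI[OF that] by (auto simp: I(2) W_def)
  have S_nonneg: "0 \<le> S w" if "w \<in> \<Omega>" for w unfolding S_def using y_w that by (intro sum_nonneg)
  have S0: "y (w x) = 0" if "w \<in> \<Omega>" "S w = 0" "x \<in> P" for w x
    using that y_w P(1) unfolding S_def by (subst (asm) sum_nonneg_eq_0_iff) auto
  have D: "0 \<le> D w x" "sum (D w) P = 1" if "w \<in> \<Omega>" "x \<in> P" for w x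
  proof -
    show "0 \<le> D w x" using y_w[OF that] S_nonneg[OF that(1)] by (simp add: D_def)
    show "sum (D w) P = 1"
    proof (cases "S w = 0")
      case False
      then show ?thesis by (simp add: D_def sum_divide_distrib[symmetric]) (simp add: S_def)
    qed (use P x0 in \<open>simp add: D_def\<close>)
  qed
  \<comment> \<open>The comparison is restricted to assignments charged by the prior; under
    \<open>\<mu>1\<close> all their weights are at least \<open>1\<close>.\<close>
  have E_mono: "E \<mu> \<phi> \<le> E \<mu> \<psi>"
    if "\<And>i. 0 \<le> \<mu> i" "\<And>w. w \<in> \<Omega> \<Longrightarrow> (\<And>x. x \<in> P \<Longrightarrow> \<mu> (w x) \<noteq> 0) \<Longrightarrow> \<phi> w \<le> \<psi> w" for \<mu> \<phi> \<psi>
    unfolding E_def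
  proof (rule sum_mono)
    fix w assume "w \<in> \<Omega>"
    show "(\<Prod>x\<in>P. \<mu> (w x)) * \<phi> w \<le> (\<Prod>x\<in>P. \<mu> (w x)) * \<psi> w"
    proof (cases "\<forall>x\<in>P. \<mu> (w x) \<noteq> 0")
      case True
      then show ?thesis using that \<open>w \<in> \<Omega>\<close> by (intro mult_left_mono prod_nonneg) auto
    next
      case False
      then have "(\<Prod>x\<in>P. \<mu> (w x)) = 0" using P by (auto simp: prod_zero_iff)
      then show ?thesis by simp
    qed
  qed
  have E_add: "E \<mu> (\<lambda>w. \<phi> w + \<psi> w) = E \<mu> \<phi> + E \<mu> \<psi>" for \<mu> \<phi> \<psi>
    by (simp add: E_def distrib_left sum.distrib)
  have E_mult: "E \<mu> (\<lambda>w. c * \<phi> w) = c * E \<mu> \<phi>" for \<mu> \<phi> c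
    by (simp add: E_def sum_distrib_left mult_ac)
  have E_const: "E \<mu> (\<lambda>w. c) = c" if "sum \<mu> I = 1" for \<mu> c
    using sum_PiE_weight[OF P(1) I(1) that] by (simp add: E_def \<Omega>_def sum_distrib_right[symmetric])
  have E_sum: "E \<mu> (\<lambda>w. \<Sum>x\<in>P. \<phi> (w x)) = N * (\<Sum>i\<in>I. \<mu> i * \<phi> i)" if "sum \<mu> I = 1" for \<mu> \<phi> :: "nat \<Rightarrow> real"
  proof -
    have "E \<mu> (\<lambda>w. \<Sum>x\<in>P. \<phi> (w x)) = (\<Sum>x\<in>P. \<Sum>w\<in>\<Omega>. (\<Prod>x\<in>P. \<mu> (w x)) * \<phi> (w x))"
      unfolding E_def sum_distrib_left by (rule sum.swap)
    also have "\<dots> = N * (\<Sum>i\<in>I. \<mu> i * \<phi> i)"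
      using that N by (simp add: \<Omega>_def sum_PiE_marginal[OF P(1) I(1)])
    finally show ?thesis .
  qed

  have thin: "\<bar>h w - g w\<bar> \<le> err w" if w: "w \<in> \<Omega>" for w
  proof -
    define p where "p = S w / (N * W)"
    have S_le: "S w \<le> N * W"
      unfolding S_def using sum_bounded_above[of P "\<lambda>x. y (w x)" W] y_w w N by simp
    have p: "0 \<le> p" "p \<le> 1"
      using S_nonneg[OF w] S_le W_pos N by (auto simp: p_def)
    have "\<bar>h w - g w\<bar> \<le> 2 ^ q * (1 - p / 2) ^ Q"
      unfolding h_def g_def
    proof (rule thinning_error[OF P(1)])
      show "thinned W N y w (x, True) = p * D w x" if "x \<in> P" for x
        using W_pos N S0[OF w _ that] by (auto simp: thinned_def p_def D_def)
      show "0 \<le> thinned W N y w (x, False)" if "x \<in> P" for x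
        using y_w[OF w that] W_pos by (simp add: thinned_def)
      show "(\<Sum>x\<in>P. thinned W N y w (x, False)) = 1 - p"
        using N W_pos by (simp add: thinned_def p_def S_def sum_subtractf sum_divide_distrib[symmetric] diff_divide_distrib mult.commute)
    qed (use D[OF w] x0 p F in auto)
    also have "(1 - p / 2) ^ Q \<le> exp (- (p / 2)) ^ Q"
      using p exp_ge_add_one_self[of "- (p / 2)"] by (intro power_mono) auto
    also have "exp (- (p / 2)) ^ Q = (\<Prod>x\<in>P. exp (- (Q / (2 * N * W)) * y (w x)))"
      by (simp add: exp_of_nat_mult[symmetric] exp_sum[OF P(1), symmetric] p_def S_def sum_distrib_left sum_divide_distrib sum_negf mult_ac)
    finally show ?thesis by (simp add: err_def)
  qed

  \<comment> \<open>The mean is \<open>2 ^ q * X ^ N\<close>. Linearising the exponential at the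
    atom \<open>i0\<close> and bounding it by \<open>1\<close> elsewhere gives
    \<open>X \<le> 1 - c / 4\<close>, hence \<open>X ^ N \<le> exp (- (Q / (8 * W)))\<close>, and
    \<open>Q / (8 * W)\<close> exceeds \<open>q + 4\<close>.\<close>
  have err_le: "E \<mu> err \<le> 1 / 16"
    if \<mu>: "\<And>i. 0 \<le> \<mu> i" "sum \<mu> I = 1" and i0: "i0 \<in> I" "0 \<le> y i0" "y i0 \<le> 121" "1 / 2 \<le> \<mu> i0 * y i0" for \<mu> i0
  proof -
    define c where "c = Q / (2 * N * W)"
    have c_nonneg: "0 \<le> c" using W_pos by (simp add: c_def)
    have cy: "c * y i0 \<le> 1"
    proof -
      have "c \<le> (N * real s / 10) / (2 * N * W)"
        unfolding c_def using W_pos Q_le by (intro divide_right_mono) auto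
      also have "\<dots> = real s / (20 * W)" using N by simp
      also have "\<dots> \<le> real s / (20 * (1920 * real s))"
        using s10 W_ge W_pos by (intro divide_left_mono) auto
      also have "\<dots> = 1 / 38400" using s10 by simp
      finally have "c * y i0 \<le> 1 / 38400 * 121" using i0 c_nonneg by (intro mult_mono) auto
      then show ?thesis by simp
    qed
    define X where "X = (\<Sum>i\<in>I. \<mu> i * exp (- c * y i))"
    have X_nonneg: "0 \<le> X" unfolding X_def using \<mu> by (intro sum_nonneg) auto
    have "E \<mu> err = 2 ^ q * (\<Sum>w\<in>\<Omega>. \<Prod>x\<in>P. \<mu> (w x) * exp (- c * y (w x)))"
      by (simp add: E_def err_def c_def prod.distrib sum_distrib_left mult_ac)
    also have "\<dots> = 2 ^ q * X ^ N"
      unfolding \<Omega>_def X_def by (subst sum_PiE_prod[OF P(1) I(1)]) (simp add: N)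
    finally have E_err: "E \<mu> err = 2 ^ q * X ^ N" .
    have "X \<le> 1 - c / 4"
    proof -
      have "X = \<mu> i0 * exp (- c * y i0) + (\<Sum>i\<in>I - {i0}. \<mu> i * exp (- c * y i))"
        unfolding X_def using i0 I by (intro sum.remove) auto
      also have "\<dots> \<le> \<mu> i0 * (1 - c * y i0 / 2) + (\<Sum>i\<in>I - {i0}. \<mu> i * 1)"
      proof (intro add_mono mult_left_mono sum_mono \<mu>)
        show "exp (- c * y i0) \<le> 1 - c * y i0 / 2"
          using exp_uminus_le_half[of "c * y i0"] cy c_nonneg i0 by simp
        show "exp (- c * y i) \<le> 1" if "i \<in> I - {i0}" for i
          using that c_nonneg y(1)[of i] by (simp add: I(2))
      qed
      also have "\<dots> = 1 - c / 2 * (\<mu> i0 * y i0)"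
      proof -
        have "sum \<mu> I = \<mu> i0 + sum \<mu> (I - {i0})" using i0 I by (intro sum.remove) auto
        then show ?thesis using \<mu>(2) by (simp add: algebra_simps)
      qed
      also have "\<dots> \<le> 1 - c / 2 * (1 / 2)"
        using i0 c_nonneg by (intro diff_left_mono mult_left_mono) auto
      finally show ?thesis by simp
    qed
    also have "1 - c / 4 \<le> exp (- (c / 4))" using exp_ge_add_one_self[of "- (c / 4)"] by simp
    finally have "X ^ N \<le> exp (- (c / 4)) ^ N" using X_nonneg by (rule power_mono)
    also have "\<dots> = exp (- (Q / (8 * W)))"
      using N by (simp add: exp_of_nat_mult[symmetric] c_def)
    finally have X_le: "X ^ N \<le> exp (- (Q / (8 * W)))" .
    have "(2::real) ^ q \<le> exp 1 ^ q"
      using exp_ge_add_one_self[of 1] by (intro power_mono) auto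
    with X_le have "E \<mu> err \<le> exp 1 ^ q * exp (- (Q / (8 * W)))"
      unfolding E_err using X_nonneg by (intro mult_mono) auto
    also have "\<dots> = exp (real q - Q / (8 * W))"
      by (simp add: exp_of_nat_mult[symmetric] exp_diff exp_minus field_simps)
    also have "\<dots> \<le> exp (- 4)"
    proof -
      have "2 ^ s / (1600000 * real s) = (N * real s / 20) / (8 * (10000 * (real s)\<^sup>2))"
        using s10 N by (simp add: power2_eq_square)
      also have "\<dots> \<le> Q / (8 * W)"
        using Q_ge W_le W_pos by (intro frac_le) auto
      finally show ?thesis using q4 by simp
    qed
    also have "exp (- 4 :: real) \<le> 1 / 16"
    proof -
      have "(2::real) ^ 4 \<le> exp 1 ^ 4" using exp_ge_add_one_self[of 1] by (intro power_mono) auto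
      also have "\<dots> = exp 4" by (simp add: exp_of_nat_mult[symmetric])
      finally show ?thesis by (simp add: exp_minus field_simps)
    qed
    finally show ?thesis .
  qed

  have g_bounds: "0 \<le> g w" "g w \<le> 1" if "w \<in> \<Omega>" for w
    unfolding g_def using iid_sum_bounds[of P "D w" F q] D[OF that] P(1) x0 F by auto
  \<comment> \<open>Markov's inequality as a linear lower bound for \<open>g\<close>: the number of
    nonzero weights has mean at most \<open>N / 80 \<le> k / 10\<close>, which costs
    \<open>2 / 3 * (1 / 10) = 1 / 15\<close>.\<close>
  have lower: "3 / 5 \<le> E \<mu>0 g"
  proof -
    have "2 / 3 + - (2 / 3 / k) * (N * (1 / 80)) \<le>
        2 / 3 + - (2 / 3 / k) * (N * (\<Sum>i\<in>I. \<mu>0 i * of_bool (y i \<noteq> 0)))"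
      using mostly_0 by (intro add_left_mono mult_left_mono_neg mult_left_mono) (auto simp: I_def)
    also have "\<dots> = E \<mu>0 (\<lambda>w. 2 / 3 + - (2 / 3 / k) * (\<Sum>x\<in>P. of_bool (y (w x) \<noteq> 0)))"
      using \<mu> E_sum[of \<mu>0 "\<lambda>i. of_bool (y i \<noteq> 0)"] by (simp only: E_add E_mult E_const I_def)
    also have "\<dots> \<le> E \<mu>0 g"
    proof (rule E_mono)
      fix w assume w: "w \<in> \<Omega>"
      define m where "m = card {x \<in> P. y (w x) \<noteq> 0}"
      have m: "(\<Sum>x\<in>P. of_bool (y (w x) \<noteq> 0)) = real m"
        using P by (simp add: m_def Int_def)
      show "2 / 3 + - (2 / 3 / k) * (\<Sum>x\<in>P. of_bool (y (w x) \<noteq> 0)) \<le> g w"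
      proof (cases "m \<le> k")
        case True
        have "card {x \<in> P. D w x \<noteq> 0} \<le> k"
        proof (cases "S w = 0")
          case True
          then have "{x \<in> P. D w x \<noteq> 0} = {x0}" using x0 by (auto simp: D_def)
          then show ?thesis using k by simp
        next
          case False
          then have "{x \<in> P. D w x \<noteq> 0} = {x \<in> P. y (w x) \<noteq> 0}" by (auto simp: D_def)
          then show ?thesis using \<open>m \<le> k\<close> by (simp add: m_def)
        qed
        then have "2 / 3 \<le> g w" unfolding g_def using D[OF w] x0 by (intro few) auto
        moreover have "- (2 / 3 / k) * real m \<le> 0" by simp
        ultimately show ?thesis unfolding m by linarith
      next
        case False
        then have "2 / 3 + - (2 / 3 / k) * real m \<le> 0" using k by (simp add: field_simps)
        then show ?thesis unfolding m using g_bounds[OF w] by linarith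
      qed
    qed (rule \<mu>)
    finally have "2 / 3 + - (2 / 3 / k) * (N * (1 / 80)) \<le> E \<mu>0 g" .
    moreover have "real N \<le> 8 * real k"
      using of_nat_mono[OF k(2), where 'a = real] by (simp add: N)
    then have "2 / 3 / k * (N * (1 / 80)) \<le> 2 / 3 / k * (8 * k * (1 / 80))"
      by (intro mult_left_mono mult_right_mono) auto
    moreover have "2 / 3 / k * (8 * k * (1 / 80)) = (1 / 15 :: real)" using k(1) by simp
    ultimately show ?thesis by linarith
  qed
  \<comment> \<open>Normalised weights are at least \<open>1 / (13 * N)\<close> unless the total
    exceeds \<open>13 * N\<close>, which Markov's inequality bounds by
    \<open>1 / 10\<close>.\<close>
  have upper: "E \<mu>1 g \<le> 1 / 3 + 1 / 10"
  proof -
    have "E \<mu>1 g \<le> E \<mu>1 (\<lambda>w. 1 / 3 + 1 / (13 * N) * S w)"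
    proof (rule E_mono)
      fix w assume w: "w \<in> \<Omega>" and nz: "\<And>x. x \<in> P \<Longrightarrow> \<mu>1 (w x) \<noteq> 0"
      have y1: "1 \<le> y (w x)" if "x \<in> P" for x using ge_1 wI[OF w that] nz[OF that] by (simp add: I(2))
      then have "N \<le> S w" unfolding S_def using sum_bounded_below[of P 1 "\<lambda>x. y (w x)"] N by simp
      moreover have "0 < real N" using N(2) by simp
      ultimately have S_pos: "0 < S w" by linarith
      show "g w \<le> 1 / 3 + 1 / (13 * N) * S w"
      proof (cases "S w \<le> 13 * N")
        case True
        have "g w \<le> 1 / 3"
          unfolding g_def
        proof (rule spread)
          show "1 / (13 * 2 ^ s) \<le> D w x" if "x \<in> P" for x
            using S_pos True y1[OF that] N by (auto simp: D_def intro!: frac_le)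
        qed (use D[OF w] x0 in auto)
        moreover have "0 \<le> 1 / (13 * N) * S w" using S_pos by simp
        ultimately show ?thesis by linarith
      next
        case False
        then have "1 \<le> 1 / (13 * N) * S w" using N by (simp add: field_simps)
        then show ?thesis using g_bounds[OF w] by linarith
      qed
    qed (rule \<mu>)
    also have "\<dots> = 1 / 3 + 1 / (13 * N) * (N * (\<Sum>i\<in>I. \<mu>1 i * y i))"
      using \<mu> E_sum[of \<mu>1 y] by (simp only: E_add E_mult E_const S_def I_def)
    also have "\<dots> = 1 / 3 + 1 / 13 * (\<Sum>i\<in>I. \<mu>1 i * y i)" using N by simp
    also have "\<dots> \<le> 1 / 3 + 1 / 13 * (13 / 10)" using mean by (simp add: I_def)
    finally show ?thesis by simp
  qed
  have "E \<mu>0 g \<le> E \<mu>0 (\<lambda>w. h w + err w)"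
    using \<mu> thin by (intro E_mono) (auto simp: abs_le_iff algebra_simps)
  also have "\<dots> \<le> E \<mu>0 h + 1 / 16"
    unfolding E_add using err_le[of \<mu>0 2] \<mu> atoms by (simp add: I_def)
  also have "E \<mu>0 h \<le> E \<mu>1 h + N * (1 + 1 / N) ^ Q / 2 ^ (J + 1 + 1)"
    unfolding E_def h_def \<Omega>_def
    by (rule mixtures_close[OF P(1) N(1,2) I(1) W_pos])
       (use y \<mu> match kept_bounds[of F] F in \<open>auto simp: I_def W_def\<close>)
  also have "E \<mu>1 h \<le> E \<mu>1 (\<lambda>w. g w + err w)"
    using \<mu> thin by (intro E_mono) (auto simp: abs_le_iff algebra_simps)
  also have "\<dots> \<le> E \<mu>1 g + 1 / 16"
    unfolding E_add using err_le[of \<mu>1 1] \<mu> atoms by (simp add: I_def)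
  \<comment> \<open>The power \<open>(1 + 1 / N) ^ Q\<close> is at most \<open>(6 / 5) ^ s\<close>,
    and \<open>2 ^ s * (6 / 5) ^ s / 2 ^ (2 * s + 1) = (3 / 5) ^ s / 2\<close>.\<close>
  also have "N * (1 + 1 / N) ^ Q / 2 ^ (J + 1 + 1) \<le> 1 / 100"
  proof -
    have J2: "J + 1 + 1 = s + s + 1" using s10 by (simp add: J_def)
    have "(1 + 1 / N) ^ Q \<le> exp (1 / N) ^ Q"
      using exp_ge_add_one_self[of "1 / N"] by (intro power_mono) auto
    also have "\<dots> = exp (Q / N)" by (simp add: exp_of_nat_mult[symmetric])
    also have "\<dots> \<le> exp (real s * (1 / 10))" using Q_le N by (simp add: field_simps)
    also have "\<dots> = exp (1 / 10) ^ s" by (rule exp_of_nat_mult)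
    also have "\<dots> \<le> (6 / 5) ^ s"
      using exp_bound[of "1 / 10 :: real"] by (intro power_mono) (auto simp: power2_eq_square)
    finally have "N * (1 + 1 / N) ^ Q / 2 ^ (J + 1 + 1) \<le> N * (6 / 5) ^ s / 2 ^ (J + 1 + 1)"
      by (intro divide_right_mono mult_left_mono) auto
    also have "\<dots> = (3 / 5 :: real) ^ s / 2"
      unfolding J2 by (simp add: N power_add power_divide field_simps power_mult_distrib[symmetric])
    also have "\<dots> \<le> (3 / 5) ^ 10 / 2"
      using s10 by (intro divide_right_mono power_decreasing) auto
    also have "\<dots> \<le> (1 / 100 :: real)" by (simp add: power_divide)
    finally show ?thesis .
  qed
  finally have "E \<mu>0 g \<le> E \<mu>1 g + 1 / 16 + 1 / 100 + 1 / 16" by simp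
  then show False using lower upper by simp
qed

section \<open>Decision trees and parity\<close>

text \<open>A coordinate on which two points differ splits \<open>S\<close> into two nonempty parts.
  With \<open>card - 1\<close> nodes for each part and one for the root, the total is
  \<open>card S - 1\<close>.\<close>

lemma exists_dtree_agreeing_on:
  assumes "finite S" "S \<subseteq> cube n" "card S \<le> Suc k"
  shows "\<exists>t. tests t \<subseteq> {..<n} \<and> inner_nodes t \<le> k \<and> (\<forall>x\<in>S. eval_dtree t x = f x)"
  using assms
proof (induction k arbitrary: S rule: less_induct)
  case (less k)
  show ?case
  proof (cases "\<exists>x\<in>S. \<exists>z\<in>S. x \<noteq> z")
    case False
    show ?thesis
    proof (cases "S = {}")
      case False
      then obtain x where "x \<in> S" by auto
      with \<open>\<not> (\<exists>x\<in>S. \<exists>z\<in>S. x \<noteq> z)\<close> have "S = {x}" by auto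
      then show ?thesis by (intro exI[of _ "Leaf (f x)"]) simp
    qed (auto intro: exI[of _ "Leaf True"])
  next
    case True
    then obtain x z where xz: "x \<in> S" "z \<in> S" "x \<noteq> z" by auto
    then have len: "length x = n" "length z = n" using less.prems by (auto simp: cube_def)
    with xz obtain i where i: "i < n" "x ! i \<noteq> z ! i" using nth_equalityI[of x z] by auto
    define S1 where "S1 = {v \<in> S. v ! i}"
    define S0 where "S0 = {v \<in> S. \<not> v ! i}"
    have fin: "finite S0" "finite S1" and sub: "S0 \<subseteq> cube n" "S1 \<subseteq> cube n"
      using less.prems by (auto simp: S0_def S1_def)
    have "S = S0 \<union> S1" "S0 \<inter> S1 = {}" by (auto simp: S0_def S1_def)
    then have "card S0 + card S1 = card S" using fin by (simp add: card_Un_disjoint)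
    moreover have "S0 \<noteq> {}" "S1 \<noteq> {}" using xz i by (auto simp: S0_def S1_def)
    then have "0 < card S0" "0 < card S1" using fin by (auto simp: card_gt_0_iff)
    ultimately have c: "card S0 \<le> Suc (card S0 - 1)" "card S1 \<le> Suc (card S1 - 1)"
      "card S0 - 1 < k" "card S1 - 1 < k" "Suc (card S0 - 1 + (card S1 - 1)) \<le> k"
      using less.prems(3) by auto
    obtain t0 where t0: "tests t0 \<subseteq> {..<n}" "inner_nodes t0 \<le> card S0 - 1" "\<forall>x\<in>S0. eval_dtree t0 x = f x"
      using less.IH[OF c(3) fin(1) sub(1) c(1)] by auto
    obtain t1 where t1: "tests t1 \<subseteq> {..<n}" "inner_nodes t1 \<le> card S1 - 1" "\<forall>x\<in>S1. eval_dtree t1 x = f x"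
      using less.IH[OF c(4) fin(2) sub(2) c(2)] by auto
    show ?thesis
      using t0 t1 i c(5) by (intro exI[of _ "Test i t0 t1"]) (auto simp: S0_def S1_def)
  qed
qed

text \<open>The function \<open>h\<close> is for the sample tester, whose acceptance is promised
  only on members of the class; the vanishing distance is for the query tester.\<close>

lemma dist_class_eq_0:
  assumes "finite (set_pmf D)" "set_pmf D \<subseteq> cube n" "card (set_pmf D) \<le> Suc k"
  obtains h where "h \<in> decision_trees n k" "\<And>x. x \<in> set_pmf D \<Longrightarrow> h x = f x"
    "dist_class D f (decision_trees n k) = 0"
proof -
  obtain t where t: "tests t \<subseteq> {..<n}" "inner_nodes t \<le> k" "\<forall>x\<in>set_pmf D. eval_dtree t x = f x"
    using exists_dtree_agreeing_on[OF assms] by blast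
  define h where "h = restrict (eval_dtree t) (cube n)"
  have h: "h \<in> decision_trees n k" using t by (auto simp: decision_trees_def h_def)
  have agree: "h x = f x" if "x \<in> set_pmf D" for x using t assms(2) that by (auto simp: h_def)
  have "dist_fun D f h = 0"
    unfolding dist_fun_def using agree by (subst measure_pmf_zero_iff) auto
  moreover have "0 \<le> dist_fun D f g" for g by (simp add: dist_fun_def)
  ultimately have "dist_class D f (decision_trees n k) = 0"
    unfolding dist_class_def using h
    by (intro antisym cINF_greatest) (auto intro!: cINF_lower2[where x = h] bdd_belowI[of _ 0])
  then show thesis using that h agree by blast
qed

section \<open>Parity on a subcube\<close>

text \<open>Points are named by their sets of ones: \<open>Pow {..<s}\<close> becomes a subcube with
  the remaining coordinates \<open>0\<close>, and parity becomes
  \<open>odd (card A)\<close>.\<close>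

definition indicator_list :: "nat \<Rightarrow> nat set \<Rightarrow> bool list" where
  "indicator_list n A = map (\<lambda>i. i \<in> A) [0..<n]"

lemma indicator_list_in_cube: "indicator_list n A \<in> cube n"
  by (simp add: indicator_list_def cube_def)

lemma nth_indicator_list [simp]: "i < n \<Longrightarrow> indicator_list n A ! i \<longleftrightarrow> i \<in> A"
  by (simp add: indicator_list_def)

lemma inj_on_indicator_list: "inj_on (indicator_list n) (Pow {..<n})"
proof (rule inj_onI)
  fix A B assume AB: "A \<in> Pow {..<n}" "B \<in> Pow {..<n}" "indicator_list n A = indicator_list n B"
  have "i \<in> A \<longleftrightarrow> i \<in> B" if "i < n" for i using AB(3) that nth_indicator_list by metis
  then show "A = B" using AB(1,2) by auto
qed

definition bsign :: "bool \<Rightarrow> int" where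
  "bsign b = (if b then 1 else - 1)"

lemma sum_Pow_insert:
  assumes "finite A" "a \<notin> A"
  shows "(\<Sum>X\<in>Pow (insert a A). f X) = (\<Sum>X\<in>Pow A. f X) + (\<Sum>X\<in>Pow A. f (insert a X))"
proof -
  have "inj_on (insert a) (Pow A)" using assms(2) by (auto simp: inj_on_def)
  then show ?thesis
    unfolding Pow_insert using assms
    by (subst sum.union_disjoint) (auto simp: sum.reindex)
qed

text \<open>A leaf of a tree computes a constant on a subcube, so it is uncorrelated with parity there
  unless the subcube is a single point.\<close>

lemma dtree_parity_correlation:
  assumes "tests t \<subseteq> {..<n}" "finite F" "finite B" "F \<inter> B = {}"
  shows "\<bar>\<Sum>A\<in>Pow F. bsign (odd (card (A \<union> B))) * bsign (eval_dtree t (indicator_list n (A \<union> B)))\<bar> \<le>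
    int (Suc (inner_nodes t))"
  using assms
\<comment> \<open>The coordinates in \<open>F\<close> are free, those in \<open>B\<close> are fixed
  to \<open>1\<close> and all others to \<open>0\<close>.\<close>
proof (induction t arbitrary: F B)
  case (Leaf b)
  show ?case
  proof (cases "F = {}")
    case False
    then obtain a where a: "a \<in> F" by auto
    define F' where "F' = F - {a}"
    have F': "F = insert a F'" "finite F'" "a \<notin> F'" using a Leaf by (auto simp: F'_def)
    have "bsign (odd (card (insert a A \<union> B))) = - bsign (odd (card (A \<union> B)))" if "A \<in> Pow F'" for A
    proof -
      have "a \<notin> A \<union> B" "finite (A \<union> B)" using that F' Leaf finite_subset by auto
      then have "card (insert a A \<union> B) = Suc (card (A \<union> B))" by simp
      then show ?thesis by (simp add: bsign_def)
    qed
    then have "(\<Sum>A\<in>Pow F. bsign (odd (card (A \<union> B))) * bsign b) = 0"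
      unfolding F'(1) sum_Pow_insert[OF F'(2,3)] by (simp add: sum_negf)
    then show ?thesis by simp
  qed (simp add: bsign_def)
next
  case (Test i t0 t1)
  have i: "i < n" and sub: "tests t0 \<subseteq> {..<n}" "tests t1 \<subseteq> {..<n}" using Test.prems by auto
  let ?g = "\<lambda>t A. bsign (odd (card A)) * bsign (eval_dtree t (indicator_list n A))"
  have ev: "?g (Test i t0 t1) A = (if i \<in> A then ?g t1 A else ?g t0 A)" for A using i by simp
  show ?case
  proof (cases "i \<in> F")
    case True
    define F' where "F' = F - {i}"
    have F': "F = insert i F'" "finite F'" "i \<notin> F'" "i \<notin> B" using True Test.prems by (auto simp: F'_def)
    have "(\<Sum>A\<in>Pow F. ?g (Test i t0 t1) (A \<union> B)) =
        (\<Sum>A\<in>Pow F'. ?g t0 (A \<union> B)) + (\<Sum>A\<in>Pow F'. ?g t1 (A \<union> insert i B))"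
      unfolding F'(1) sum_Pow_insert[OF F'(2,3)] ev using F'
      by (intro arg_cong2[where f = "(+)"] sum.cong) auto
    moreover have "\<bar>\<Sum>A\<in>Pow F'. ?g t0 (A \<union> B)\<bar> \<le> int (Suc (inner_nodes t0))"
      using Test.prems F' sub by (intro Test.IH) auto
    moreover have "\<bar>\<Sum>A\<in>Pow F'. ?g t1 (A \<union> insert i B)\<bar> \<le> int (Suc (inner_nodes t1))"
      using Test.prems F' sub by (intro Test.IH) auto
    ultimately show ?thesis by simp
  next
    case False
    \<comment> \<open>The subcube fixes coordinate \<open>i\<close>, so only this subtree is
      reached.\<close>
    define u where "u = (if i \<in> B then t1 else t0)"
    have "(\<Sum>A\<in>Pow F. ?g (Test i t0 t1) (A \<union> B)) = (\<Sum>A\<in>Pow F. ?g u (A \<union> B))"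
      unfolding ev using False by (intro sum.cong) (auto simp: u_def)
    also have "\<bar>\<dots>\<bar> \<le> int (Suc (inner_nodes u))"
      using Test.IH(1)[OF sub(1) Test.prems(2-4)] Test.IH(2)[OF sub(2) Test.prems(2-4)]
      by (simp add: u_def)
    finally show ?thesis by (auto simp: u_def split: if_splits)
  qed
qed

text \<open>The correlation of the tree with parity is \<open>2 ^ s\<close> minus twice the number
  of disagreements.\<close>

lemma parity_disagreements:
  assumes "s \<le> n" "tests t \<subseteq> {..<n}"
  shows "2 ^ s \<le> 2 * card {A \<in> Pow {..<s}. odd (card A) \<noteq> eval_dtree t (indicator_list n A)} + Suc (inner_nodes t)"
proof -
  let ?d = "\<lambda>A. odd (card A) \<noteq> eval_dtree t (indicator_list n A)"
  have "(\<Sum>A\<in>Pow {..<s}. bsign (odd (card A)) * bsign (eval_dtree t (indicator_list n A))) =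
      (\<Sum>A\<in>Pow {..<s}. 1 - 2 * of_bool (?d A))"
    by (intro sum.cong) (auto simp: bsign_def)
  also have "\<dots> = 2 ^ s - 2 * int (card {A \<in> Pow {..<s}. ?d A})"
    by (simp add: sum_subtractf sum_distrib_left[symmetric] card_Pow Int_def)
  finally have "2 ^ s - 2 * int (card {A \<in> Pow {..<s}. ?d A}) \<le> int (Suc (inner_nodes t))"
    using dtree_parity_correlation[OF assms(2), of "{..<s}" "{}"] by simp
  then have "int (2 ^ s) \<le> int (2 * card {A \<in> Pow {..<s}. ?d A} + Suc (inner_nodes t))" by simp
  then show ?thesis by (simp only: of_nat_le_iff)
qed

lemma parity_far_from_decision_trees:
  fixes D :: "bool list pmf"
  assumes s: "s \<le> n" "4 * k \<le> 2 ^ s" "1 \<le> k"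
    and f: "\<And>A. A \<subseteq> {..<s} \<Longrightarrow> f (indicator_list n A) = odd (card A)"
    and D: "\<And>A. A \<subseteq> {..<s} \<Longrightarrow> c / 2 ^ s \<le> pmf D (indicator_list n A)" and c: "0 \<le> c"
  shows "c / 4 \<le> dist_class D f (decision_trees n k)"
  unfolding dist_class_def
proof (rule cINF_greatest)
  show "decision_trees n k \<noteq> {}"
    by (auto simp: decision_trees_def intro!: exI[of _ "Leaf True"])
next
  fix h assume "h \<in> decision_trees n k"
  then obtain t where h: "h = restrict (eval_dtree t) (cube n)" and t: "tests t \<subseteq> {..<n}" "inner_nodes t \<le> k"
    by (auto simp: decision_trees_def)
  define T where "T = {A \<in> Pow {..<s}. odd (card A) \<noteq> eval_dtree t (indicator_list n A)}"
  have fin: "finite T" by (simp add: T_def)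
  have "2 ^ s \<le> 2 * card T + Suc k"
    using parity_disagreements[OF s(1) t(1)] t(2) unfolding T_def by linarith
  \<comment> \<open>As \<open>Suc k \<le> 2 * k\<close> and \<open>4 * k \<le> 2 ^ s\<close>, a tree
    errs on at least a quarter of the subcube.\<close>
  then have "2 ^ s \<le> 4 * card T" using s by linarith
  then have cT: "2 ^ s \<le> 4 * real (card T)"
    by (metis of_nat_le_iff of_nat_mult of_nat_numeral of_nat_power)
  have inj: "inj_on (indicator_list n) T"
    using s by (intro inj_on_subset[OF inj_on_indicator_list]) (auto simp: T_def)
  have "c / 4 = (c / 2 ^ s) * (2 ^ s / 4)" by simp
  also have "\<dots> \<le> (c / 2 ^ s) * card T" using cT c by (intro mult_left_mono) auto
  also have "\<dots> = (\<Sum>A\<in>T. c / 2 ^ s)" by simp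
  also have "\<dots> \<le> (\<Sum>A\<in>T. pmf D (indicator_list n A))" using D by (intro sum_mono) (auto simp: T_def)
  also have "\<dots> = measure_pmf.prob D (indicator_list n ` T)"
    using fin inj by (simp add: measure_measure_pmf_finite sum.reindex)
  also have "\<dots> \<le> dist_fun D f h"
    unfolding dist_fun_def
    by (intro measure_pmf.finite_measure_mono) (auto simp: T_def h f indicator_list_in_cube)
  finally show "c / 4 \<le> dist_fun D f h" .
qed

section \<open>Testers\<close>

lemma pmf_bind_replicate_pmf:
  assumes "finite P" "set_pmf D \<subseteq> P"
  shows "pmf (bind_pmf (replicate_pmf q D) G) b = iid_sum P (pmf D) q (\<lambda>xs. pmf (G xs) b)"
proof (induction q arbitrary: G)
  case 0
  show ?case by (simp add: bind_return_pmf)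
next
  case (Suc q)
  have "pmf (bind_pmf (replicate_pmf (Suc q) D) G) b =
      measure_pmf.expectation D (\<lambda>x. pmf (bind_pmf (replicate_pmf q D) (\<lambda>xs. G (x # xs))) b)"
    by (simp add: bind_assoc_pmf bind_return_pmf pmf_bind)
  also have "\<dots> = (\<Sum>x\<in>P. pmf (bind_pmf (replicate_pmf q D) (\<lambda>xs. G (x # xs))) b * pmf D x)"
    using assms by (intro integral_measure_pmf_real) auto
  finally show ?case by (simp add: Suc iid_sum_Suc mult.commute)
qed

lemma pmf_of_weights:
  fixes D :: "'a \<Rightarrow> real"
  assumes "finite P" "\<And>x. x \<in> P \<Longrightarrow> 0 \<le> D x" "sum D P = 1"
  obtains M where "set_pmf M = {x \<in> P. D x \<noteq> 0}" "\<And>x. x \<in> P \<Longrightarrow> pmf M x = D x"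
proof -
  define d where "d = (\<lambda>x. if x \<in> P then D x else 0)"
  have d: "0 \<le> d x" for x using assms by (simp add: d_def)
  have "(\<integral>\<^sup>+ x. ennreal (d x) \<partial>count_space UNIV) = (\<Sum>x\<in>P. ennreal (d x))"
    using assms(1) by (intro nn_integral_count_space') (auto simp: d_def)
  also have "\<dots> = ennreal (\<Sum>x\<in>P. d x)" using d by (simp add: sum_ennreal)
  also have "(\<Sum>x\<in>P. d x) = 1" using assms(3) by (simp add: d_def)
  finally have "(\<integral>\<^sup>+ x. ennreal (d x) \<partial>count_space UNIV) = 1" by simp
  then have pmf: "pmf (embed_pmf d) x = d x" for x using d by (intro pmf_embed_pmf)
  have "set_pmf (embed_pmf d) = {x. d x \<noteq> 0}" by (simp add: set_pmf_eq pmf)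
  also have "\<dots> = {x \<in> P. D x \<noteq> 0}" by (auto simp: d_def)
  finally show thesis by (rule that[of "embed_pmf d"]) (simp add: pmf, simp add: d_def)
qed

text \<open>With \<open>f\<close> fixed, labels carry no information, so the tester is a function
  \<open>G\<close> of unlabelled points. The distance \<open>1 / 52\<close> is a quarter of the
  subcube times \<open>1 / 13\<close> of the uniform density.\<close>

lemma parity_tester_sample_bound:
  fixes G :: "bool list list \<Rightarrow> bool pmf" and n s :: nat
  defines "P \<equiv> indicator_list n ` Pow {..<s}"
  assumes s: "s \<le> n" "4 * k \<le> 2 ^ s" "2 ^ s \<le> 8 * k" "1 \<le> k"
    and f: "\<And>A. A \<subseteq> {..<s} \<Longrightarrow> f (indicator_list n A) = odd (card A)"
    and accepts: "\<And>D. set_pmf D \<subseteq> P \<Longrightarrow> card (set_pmf D) \<le> k \<Longrightarrow>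
      2 / 3 \<le> pmf (bind_pmf (replicate_pmf q D) G) True"
    and rejects: "\<And>D. set_pmf D \<subseteq> P \<Longrightarrow> 1 / 52 \<le> dist_class D f (decision_trees n k) \<Longrightarrow>
      2 / 3 \<le> pmf (bind_pmf (replicate_pmf q D) G) False"
  shows "2 ^ s / (8000000 * real s) \<le> real q"
proof (rule few_or_spread_sample_bound)
  have inj: "inj_on (indicator_list n) (Pow {..<s})"
    using s by (intro inj_on_subset[OF inj_on_indicator_list]) auto
  show fin: "finite P" by (simp add: P_def)
  show "card P = 2 ^ s" unfolding P_def using inj by (simp add: card_image card_Pow)
  have eq: "iid_sum P D q (\<lambda>xs. pmf (G xs) b) = pmf (bind_pmf (replicate_pmf q M) G) b"
    if "set_pmf M \<subseteq> P" "\<And>x. x \<in> P \<Longrightarrow> pmf M x = D x" for M D b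
  proof -
    have "prod_list (map D xs) = prod_list (map (pmf M) xs)" if "set xs \<subseteq> P" for xs
      using that \<open>\<And>x. x \<in> P \<Longrightarrow> pmf M x = D x\<close> by (intro arg_cong[where f = prod_list]) auto
    then show ?thesis
      unfolding pmf_bind_replicate_pmf[OF fin that(1)] iid_sum_def by (intro sum.cong) auto
  qed
  show "2 / 3 \<le> iid_sum P D q (\<lambda>xs. pmf (G xs) True)"
    if D: "\<And>x. x \<in> P \<Longrightarrow> 0 \<le> D x" "sum D P = 1" "card {x \<in> P. D x \<noteq> 0} \<le> k" for D
  proof -
    obtain M where M: "set_pmf M = {x \<in> P. D x \<noteq> 0}" "\<And>x. x \<in> P \<Longrightarrow> pmf M x = D x"
      using pmf_of_weights[OF fin D(1,2)] by metis
    have sub: "set_pmf M \<subseteq> P" using M by auto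
    have "iid_sum P D q (\<lambda>xs. pmf (G xs) True) = pmf (bind_pmf (replicate_pmf q M) G) True"
      by (rule eq[OF sub]) (rule M(2))
    then show ?thesis using accepts[OF sub] D(3) by (simp add: M(1))
  qed
  show "iid_sum P D q (\<lambda>xs. pmf (G xs) True) \<le> 1 / 3"
    if D: "\<And>x. x \<in> P \<Longrightarrow> 1 / (13 * 2 ^ s) \<le> D x" "sum D P = 1" for D
  proof -
    have "0 \<le> D x" if "x \<in> P" for x by (rule order_trans[OF _ D(1)[OF that]]) simp
    then obtain M where M: "set_pmf M = {x \<in> P. D x \<noteq> 0}" "\<And>x. x \<in> P \<Longrightarrow> pmf M x = D x"
      using pmf_of_weights[OF fin _ D(2)] by metis
    have sub: "set_pmf M \<subseteq> P" using M by auto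
    have "1 / 13 / 2 ^ s \<le> pmf M (indicator_list n A)" if "A \<subseteq> {..<s}" for A
      using D(1)[of "indicator_list n A"] M(2)[of "indicator_list n A"] that by (simp add: P_def)
    then have "1 / 13 / 4 \<le> dist_class M f (decision_trees n k)"
      using s f by (intro parity_far_from_decision_trees) auto
    then have "2 / 3 \<le> pmf (bind_pmf (replicate_pmf q M) G) False"
      using sub by (intro rejects) auto
    moreover have "iid_sum P D q (\<lambda>xs. pmf (G xs) True) = pmf (bind_pmf (replicate_pmf q M) G) True"
      by (rule eq[OF sub]) (rule M(2))
    ultimately show ?thesis by (simp add: pmf_False_conv_True)
  qed
qed (use s in \<open>auto simp: pmf_le_1\<close>)

section \<open>Elimination of queries\<close>

text \<open>For a known labelling, queries need no oracle, and a run becomes a function of points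
  drawn in advance.\<close>

primrec verdict :: "('a \<Rightarrow> bool) \<Rightarrow> 'a alg \<Rightarrow> 'a list \<Rightarrow> bool" where
  "verdict f (Verdict b) xs = b"
| "verdict f (Query x K) xs = verdict f (K (f x)) xs"
| "verdict f (Sample K) xs = (case xs of [] \<Rightarrow> False | x # xs' \<Rightarrow> verdict f (K (x, f x)) xs')"

lemma run_alg_eq_map_replicate_pmf:
  assumes "cost_le X q A" "set_pmf D \<subseteq> X" "q \<le> m"
  shows "run_alg D f A = map_pmf (verdict f A) (replicate_pmf m D)"
  using assms
proof (induction arbitrary: m rule: cost_le.induct)
  case (1 q b)
  then show ?case by (simp add: map_pmf_const)
next
  case (2 x q K)
  have "run_alg D f (K (f x)) = map_pmf (verdict f (K (f x))) (replicate_pmf m D)"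
    using 2 by auto
  then show ?case by (simp add: map_pmf_def)
next
  case (3 q K)
  then obtain m' where m: "m = Suc m'" "q \<le> m'" by (cases m) auto
  have "run_alg D f (Sample K) = bind_pmf D (\<lambda>x. map_pmf (verdict f (K (x, f x))) (replicate_pmf m' D))"
    using 3 m by (auto intro!: bind_pmf_cong)
  also have "\<dots> = map_pmf (verdict f (Sample K)) (replicate_pmf m D)"
    by (simp add: m(1) map_pmf_def bind_assoc_pmf bind_return_pmf)
  finally show ?case .
qed

lemma ereal_le_Inf_enat:
  assumes "\<And>q. Q q \<Longrightarrow> B \<le> real q"
  shows "ereal B \<le> ereal_of_enat (Inf {enat q | q. Q q})"
proof -
  have "enat (nat \<lceil>B\<rceil>) \<le> Inf {enat q | q. Q q}"
    using assms by (intro Inf_greatest) (auto simp: nat_ceiling_le_eq)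
  then have "ereal_of_enat (enat (nat \<lceil>B\<rceil>)) \<le> ereal_of_enat (Inf {enat q | q. Q q})"
    by (simp only: ereal_of_enat_le_iff)
  moreover have "ereal B \<le> ereal_of_enat (enat (nat \<lceil>B\<rceil>))"
    by (simp only: ereal_of_enat_simps ereal_less_eq real_nat_ceiling_ge)
  ultimately show ?thesis by (rule order_trans[rotated])
qed

theorem theorem4p7:
  "\<exists>a c \<epsilon>\<^sub>0 :: real. a > 0 \<and> c > 0 \<and> \<epsilon>\<^sub>0 > 0 \<and>
     (\<forall>(k::nat) (n::nat) (\<epsilon>::real).
        k \<ge> 3 \<longrightarrow> real n \<ge> log 2 (real k) + log 2 (log 2 (real k)) + a \<longrightarrow>
        0 < \<epsilon> \<longrightarrow> \<epsilon> < \<epsilon>\<^sub>0 \<longrightarrow>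
        ereal_of_enat (m_test (cube n) (decision_trees n k) \<epsilon>)
          \<ge> ereal (c * (real k / (log 2 (real k) * log 2 (log 2 (real k))))) \<and>
        ereal_of_enat (q_test_0 (cube n) (decision_trees n k) \<epsilon>)
          \<ge> ereal (c * (real k / (log 2 (real k) * log 2 (log 2 (real k))))))"
\<comment> \<open>\<open>3\<close> comes from \<open>s \<le> log 2 k + 3\<close>, which makes the
  subcube fit into the cube; \<open>1 / 52\<close> is the distance of parity under spread
  distributions; \<open>1 / 10 ^ 8\<close> leaves room for the comparison
  \<open>B_le\<close>.\<close>
proof (rule exI[of _ 3], rule exI[of _ "1 / 10 ^ 8"], rule exI[of _ "1 / 52"], intro conjI allI impI)
  fix k n :: nat and \<epsilon> :: real
  assume k: "3 \<le> k" and n: "log 2 (real k) + log 2 (log 2 (real k)) + 3 \<le> real n"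
    and \<epsilon>: "0 < \<epsilon>" "\<epsilon> < 1 / 52"
  define B where "B = 1 / 10 ^ 8 * (real k / (log 2 (real k) * log 2 (log 2 (real k))))"
  let ?H = "decision_trees n k"
  obtain m where m: "2 ^ m \<le> k" "k < 2 ^ (m + 1)"
    using ex_power_ivl1[of 2 k] k by auto
  define s where "s = m + 3"
  have s: "4 * k \<le> 2 ^ s" "2 ^ s \<le> 8 * k"
    using m by (simp_all add: s_def power_add)
  have log_k: "3 / 2 \<le> log 2 (real k)"
  proof -
    have "2 powr (3 / 2) \<le> (3 :: real)"
    proof (rule power2_le_imp_le)
      have "(2 powr (3 / 2) :: real)\<^sup>2 = 2 powr 3" by (simp add: power2_eq_square powr_add[symmetric])
      then show "(2 powr (3 / 2) :: real)\<^sup>2 \<le> 3\<^sup>2" by simp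
    qed simp
    then have "2 powr (3 / 2) \<le> real k" using k by linarith
    then show ?thesis using k by (subst le_log_iff) auto
  qed
  \<comment> \<open>The bound obtained is of order \<open>k / log 2 k\<close>; this inequality
    weakens it to the one claimed, at the cost of a factor \<open>2\<close>.\<close>
  have log_log_k: "1 / 2 \<le> log 2 (log 2 (real k))"
  proof -
    have "2 powr (1 / 2) \<le> (3 / 2 :: real)"
    proof (rule power2_le_imp_le)
      have "(2 powr (1 / 2) :: real)\<^sup>2 = 2 powr 1" by (simp add: power2_eq_square powr_add[symmetric])
      then show "(2 powr (1 / 2) :: real)\<^sup>2 \<le> (3 / 2)\<^sup>2" by (simp add: power2_eq_square)
    qed simp
    then have "2 powr (1 / 2) \<le> log 2 (real k)" using log_k by linarith
    then show ?thesis using log_k by (subst le_log_iff) auto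
  qed
  have "real m \<le> log 2 (real k)"
  proof -
    have "2 powr real m \<le> real k" using m(1) by (simp add: powr_realpow flip: of_nat_le_iff)
    then show ?thesis using k by (subst le_log_iff) auto
  qed
  then have s_log: "real s \<le> log 2 (real k) + 3" by (simp add: s_def)
  then have "real s \<le> real n" using n log_log_k by linarith
  then have s_n: "s \<le> n" by simp
  have B_le: "B \<le> 2 ^ s / (8000000 * real s)"
  proof -
    have "B \<le> 1 / 10 ^ 8 * (real k / (log 2 (real k) * (1 / 2)))"
      unfolding B_def using log_k log_log_k
      by (intro mult_left_mono divide_left_mono mult_pos_pos) auto
    also have "\<dots> \<le> (4 * real k) / (8000000 * (3 * log 2 (real k)))"
      using log_k by (simp add: field_simps)
    also have "\<dots> \<le> 2 ^ s / (8000000 * real s)"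
    proof (rule frac_le)
      show "4 * real k \<le> 2 ^ s" using s(1) by (metis of_nat_le_iff of_nat_mult of_nat_numeral of_nat_power)
      show "8000000 * real s \<le> 8000000 * (3 * log 2 (real k))" using s_log log_k by simp
    qed (simp_all add: s_def)
    finally show ?thesis .
  qed
  define f where "f = restrict (\<lambda>x. odd (card {i. i < s \<and> x ! i})) (cube n)"
  have f_fun: "f \<in> cube n \<rightarrow>\<^sub>E UNIV" by (simp add: f_def)
  have f: "f (indicator_list n A) = odd (card A)" if "A \<subseteq> {..<s}" for A
  proof -
    have "{i. i < s \<and> indicator_list n A ! i} = A" using that s_n by auto
    then show ?thesis by (simp add: f_def indicator_list_in_cube)
  qed
  have sub: "indicator_list n ` Pow {..<s} \<subseteq> cube n" by (auto simp: indicator_list_in_cube)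
  have bound: "B \<le> real q"
    if "\<And>D. set_pmf D \<subseteq> indicator_list n ` Pow {..<s} \<Longrightarrow> card (set_pmf D) \<le> k \<Longrightarrow>
        2 / 3 \<le> pmf (bind_pmf (replicate_pmf q D) G) True"
      and "\<And>D. set_pmf D \<subseteq> indicator_list n ` Pow {..<s} \<Longrightarrow> 1 / 52 \<le> dist_class D f ?H \<Longrightarrow>
        2 / 3 \<le> pmf (bind_pmf (replicate_pmf q D) G) False"
    for G :: "bool list list \<Rightarrow> bool pmf" and q
    using k by (intro order_trans[OF B_le] parity_tester_sample_bound[OF s_n s _ f that]) simp_all
  have small: "finite (set_pmf D)" if "set_pmf D \<subseteq> indicator_list n ` Pow {..<s}" for D
    using that by (rule finite_subset) simp

  have "B \<le> real q" if "sample_tester (cube n) ?H \<epsilon> q A" for q A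
  proof -
    let ?G = "\<lambda>xs. A (map (\<lambda>x. (x, f x)) xs)"
    have run: "bind_pmf (labelled_samples q D f) A = bind_pmf (replicate_pmf q D) ?G" for D
      by (simp add: labelled_samples_def bind_map_pmf)
    show ?thesis
    proof (rule bound[where G = ?G])
      fix D assume D: "set_pmf D \<subseteq> indicator_list n ` Pow {..<s}" "card (set_pmf D) \<le> k"
      then have D_cube: "set_pmf D \<subseteq> cube n" using sub by auto
      \<comment> \<open>Parity is not a member of the class, so acceptance is transferred from
        \<open>h\<close>, which yields the same labelled samples on the support of
        \<open>D\<close>.\<close>
      obtain h where h: "h \<in> ?H" "\<And>x. x \<in> set_pmf D \<Longrightarrow> h x = f x"
        using dist_class_eq_0[OF small[OF D(1)] D_cube, of k f] D(2) by auto
      have "labelled_samples q D h = labelled_samples q D f"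
        unfolding labelled_samples_def using h(2)
        by (intro map_pmf_cong) (auto simp: set_replicate_pmf)
      moreover have "h \<in> cube n \<rightarrow>\<^sub>E UNIV" using h(1) by (auto simp: decision_trees_def)
      ultimately show "2 / 3 \<le> pmf (bind_pmf (replicate_pmf q D) ?G) True"
        using that D_cube h(1) unfolding sample_tester_def run[symmetric] by metis
    next
      fix D assume D: "set_pmf D \<subseteq> indicator_list n ` Pow {..<s}" "1 / 52 \<le> dist_class D f ?H"
      then have "set_pmf D \<subseteq> cube n" "\<epsilon> \<le> dist_class D f ?H" using sub \<epsilon> by auto
      then show "2 / 3 \<le> pmf (bind_pmf (replicate_pmf q D) ?G) False"
        using that f_fun unfolding sample_tester_def run[symmetric] by metis
    qed
  qed
  then show "ereal (1 / 10 ^ 8 * (real k / (log 2 (real k) * log 2 (log 2 (real k))))) \<le>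
      ereal_of_enat (m_test (cube n) ?H \<epsilon>)"
    unfolding B_def[symmetric] m_test_def by (intro ereal_le_Inf_enat) auto

  have "B \<le> real q" if "query_tester_0 (cube n) ?H \<epsilon> q R" for q R
  proof -
    \<comment> \<open>The random choice of the deterministic algorithm is moved after the draws,
      with which it commutes.\<close>
    let ?G = "\<lambda>xs. map_pmf (\<lambda>A. verdict f A xs) R"
    have run: "bind_pmf R (run_alg D f) = bind_pmf (replicate_pmf q D) ?G" if "set_pmf D \<subseteq> cube n" for D
    proof -
      have "bind_pmf R (run_alg D f) = bind_pmf R (\<lambda>A. map_pmf (verdict f A) (replicate_pmf q D))"
        using \<open>query_tester_0 (cube n) ?H \<epsilon> q R\<close> that unfolding query_tester_0_def
        by (intro bind_pmf_cong) (auto intro: run_alg_eq_map_replicate_pmf)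
      also have "\<dots> = bind_pmf (replicate_pmf q D) ?G"
        unfolding map_pmf_def by (rule bind_commute_pmf)
      finally show ?thesis .
    qed
    show ?thesis
    proof (rule bound[where G = ?G])
      fix D assume D: "set_pmf D \<subseteq> indicator_list n ` Pow {..<s}" "card (set_pmf D) \<le> k"
      then have D_cube: "set_pmf D \<subseteq> cube n" using sub by auto
      have "dist_class D f ?H = 0"
        using dist_class_eq_0[OF small[OF D(1)] D_cube, of k f] D(2) by auto
      then show "2 / 3 \<le> pmf (bind_pmf (replicate_pmf q D) ?G) True"
        using that D_cube f_fun unfolding query_tester_0_def run[OF D_cube, symmetric] by metis
    next
      fix D assume D: "set_pmf D \<subseteq> indicator_list n ` Pow {..<s}" "1 / 52 \<le> dist_class D f ?H"
      then have D_cube: "set_pmf D \<subseteq> cube n" and "\<epsilon> \<le> dist_class D f ?H" using sub \<epsilon> by auto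
      then show "2 / 3 \<le> pmf (bind_pmf (replicate_pmf q D) ?G) False"
        using that f_fun unfolding query_tester_0_def run[OF D_cube, symmetric] by metis
    qed
  qed
  then show "ereal (1 / 10 ^ 8 * (real k / (log 2 (real k) * log 2 (log 2 (real k))))) \<le>
      ereal_of_enat (q_test_0 (cube n) ?H \<epsilon>)"
    unfolding B_def[symmetric] q_test_0_def by (intro ereal_le_Inf_enat) auto
qed simp_all

end
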